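(* Let $(V,G)$ be an absolutely irreducible representation of the finite group $G$ which has quadratic equivariants and satisfies Property $(\mathcal{G})$. Then for every stable family $f\in\mathcal{S}(V,G)$ and every non-trivial solution branch class $[\gamma]\in\Sigma^\star(f)$ we have $\mathrm{index}([\gamma])\in[1,\dim(V)-1]$. In particular, every non-trivial branch is a branch of hyperbolic saddles and so there are no non-trivial branches of sinks or sources.
   Context: Representations: $V$ is a finite-dimensional real inner product space and the finite group $G$ acts orthogonally on $V$. The irreducible representation $(V,G)$ is absolutely irreducible if the only $G$-equivariant linear maps $V\to V$ are real multiples of the identity; absolutely irreducible representations are always assumed non-trivial. Families: $\mathcal{V}=\mathcal{V}(V,G)$ is the set of $C^\infty$ maps $f:V\times\mathbb{R}\to V$ which are $G$-equivariant ($G$ acting trivially on $\mathbb{R}$) and of the form $f(v,\lambda)=f_\lambda(v)=\lambda v+F(v,\lambda)$, where for all $\lambda$ the $V$-derivative of $F_\lambda=F(\cdot,\lambda)$ at $0$ is zero. $Df_{\lambda,v}$ denotes the derivative of $f_\lambda$ at $v$. $\mathcal{V}^r$ is $\mathcal{V}$ with the topology of uniform convergence of derivatives (in $(v,\lambda)$) of order $\le r$ on compact subsets of $V\times\mathbb{R}$. Solution branches: a solution branch of $f$ is a $C^1$-embedding $\gamma=(x,\lambda):[0,\delta]\to V\times\mathbb{R}$ with $\gamma(0)=(0,0)$ and $f_{\lambda(s)}(x(s))=0$ for all $s$. If $\delta>0$ can be chosen so that: $x\not\equiv0$ on $(0,\delta]$, the branch is non-trivial; $\lambda(s)>0$ (resp.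 $<0$) on $(0,\delta]$, it is forward (resp. backward); $x(s)$ is a hyperbolic zero of $f_{\lambda(s)}$ for $s\in(0,\delta]$, it is hyperbolic. Two branches $\gamma,\rho$ are equivalent if $\gamma\circ\alpha=\rho$ near $0$ for some $C^1$ diffeomorphism $\alpha:[0,\varepsilon_1]\to[0,\varepsilon_2]$ with $\alpha(0)=0$. $\Sigma(f)$ (resp. $\Sigma^\star(f)$) is the $G$-set of equivalence classes of solution (resp. non-trivial solution) branches. The index of a hyperbolic zero is the number of eigenvalues (with multiplicity) of the linearization with strictly negative real part; it is constant along a hyperbolic branch, and defines $\mathrm{index}([\gamma])\in\{0,\dots,\dim V\}$. $\mathrm{sgn}([\gamma])=+1$ (forward) or $-1$ (backward). A hyperbolic branch is either forward or backward. A hyperbolic saddle is a hyperbolic zero of index $\ne0,\dim V$. When $\Sigma(f_1),\Sigma(f_2)$ are finite and consist of hyperbolic branches, $\Sigma^\star(f_1)$ and $\Sigma^\star(f_2)$ are isomorphic if there is a $G$-equivariant bijection between them preserving $\mathrm{sgn}$ and $\mathrm{index}$. Stable families: $f\in\mathcal{V}$ is stable if (1) $\Sigma(f)$ is finite and consists of hyperbolic solution branches; (2) for some $r\ge1$ there is a neighbourhood $U$ of $f$ in $\mathcal{V}^r$ such that for every continuous curve $(\mathbf f_t)_{t\in[0,1]}$ in $U$ with $\mathbf f_0=f$: (a) there is $\delta>0$ such that for every $[\gamma]\in\Sigma(f)$ there is a continuous family $(\gamma_t)_{t\in[0,1]}$ of $C^1$ maps $[0,\delta]\to V\times\mathbb{R}$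 with each $\gamma_t$ a branch of hyperbolic zeros of $\mathbf f_t$ and $[\gamma_0]=[\gamma]$; (b) $\Sigma^\star(f)$ and $\Sigma^\star(\mathbf f_t)$ are isomorphic for all $t\in[0,1]$. $\mathcal{S}=\mathcal{S}(V,G)$ is the set of stable families. Quadratic equivariants and Property $(\mathcal{G})$: $P_G^{(2)}(V,V)$ is the space of $G$-equivariant homogeneous quadratic polynomial maps $V\to V$; $(V,G)$ has quadratic equivariants if this space is non-zero. Let $S(V)$ be the unit sphere of $V$, and for $Q\in P_G^{(2)}(V,V)$ let $\mathbf{Z}(Q)=\{u\in S(V): Q(u)=0\}$. Let $\mathcal{Q}_0$ be the set of non-zero $Q\in P_G^{(2)}(V,V)$ such that for all $u\in\mathbf{Z}(Q)$, the derivative $DQ_u$ has an eigenvalue with non-zero real part. $(V,G)$ satisfies Property $(\mathcal{G})$ if $\mathcal{Q}_0$ is an open and dense subset of $P_G^{(2)}(V,V)$. *)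

theory Defs
  imports
    "HOL-Analysis.Analysis"
    "HOL-Algebra.Group_Action"
    "Jordan_Normal_Form.Char_Poly"
begin

subsection \<open>Representations\<close>

definition orthogonal_representation ::
  "('g, 'm) monoid_scheme \<Rightarrow> ('g \<Rightarrow> 'a::euclidean_space \<Rightarrow> 'a) \<Rightarrow> bool" where
  "orthogonal_representation G \<phi> \<longleftrightarrow>
     finite (carrier G) \<and> group_action G UNIV \<phi> \<and>
     (\<forall>g\<in>carrier G. orthogonal_transformation (\<phi> g))"

definition equivariant ::
  "('g, 'm) monoid_scheme \<Rightarrow> ('g \<Rightarrow> 'a \<Rightarrow> 'a) \<Rightarrow> ('a \<Rightarrow> 'a) \<Rightarrow> bool" where
  "equivariant G \<phi> h \<longleftrightarrow> (\<forall>g\<in>carrier G. \<forall>v. h (\<phi> g v) = \<phi> g (h v))"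

definition irreducible_representation ::
  "('g, 'm) monoid_scheme \<Rightarrow> ('g \<Rightarrow> 'a::euclidean_space \<Rightarrow> 'a) \<Rightarrow> bool" where
  "irreducible_representation G \<phi> \<longleftrightarrow>
     (\<forall>W. subspace W \<and> (\<forall>g\<in>carrier G. \<phi> g ` W \<subseteq> W) \<longrightarrow> W = {0} \<or> W = UNIV)"

text \<open>Non-triviality (some group element acts non-trivially) is part of the definition.\<close>

definition absolutely_irreducible ::
  "('g, 'm) monoid_scheme \<Rightarrow> ('g \<Rightarrow> 'a::euclidean_space \<Rightarrow> 'a) \<Rightarrow> bool" where
  "absolutely_irreducible G \<phi> \<longleftrightarrow>
     orthogonal_representation G \<phi> \<and> irreducible_representation G \<phi> \<and>
     (\<forall>L. linear L \<and> equivariant G \<phi> L \<longrightarrow> (\<exists>c::real. \<forall>v. L v = c *\<^sub>R v)) \<and>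
     (\<exists>g\<in>carrier G. \<exists>v. \<phi> g v \<noteq> v)"

subsection \<open>Complex eigenvalues of real linear maps\<close>

definition basis_list :: "'a::euclidean_space list" where
  "basis_list = (SOME bs. distinct bs \<and> set bs = Basis)"

lemma basis_list: "distinct (basis_list :: 'a::euclidean_space list)"
  "set (basis_list :: 'a list) = Basis"
proof -
  have "\<exists>bs :: 'a list. distinct bs \<and> set bs = Basis"
    using finite_distinct_list[OF finite_Basis] by blast
  then have "distinct (basis_list :: 'a list) \<and> set (basis_list :: 'a list) = Basis"
    unfolding basis_list_def by (rule someI_ex)
  then show "distinct (basis_list :: 'a list)" "set (basis_list :: 'a list) = Basis" by auto
qed

lemma length_basis_list: "length (basis_list :: 'a::euclidean_space list) = DIM('a)"
  by (metis basis_list distinct_card)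

text \<open>The matrix of \<open>L\<close> in an orthonormal basis, with entries regarded as complex numbers.
  Eigenvalues and characteristic polynomial do not depend on the enumeration of the basis.\<close>

definition complex_matrix :: "('a::euclidean_space \<Rightarrow> 'a) \<Rightarrow> complex mat" where
  "complex_matrix L =
     mat DIM('a) DIM('a) (\<lambda>(i, j). complex_of_real (inner (L (basis_list ! j)) (basis_list ! i)))"

definition is_eigenvalue :: "('a::euclidean_space \<Rightarrow> 'a) \<Rightarrow> complex \<Rightarrow> bool" where
  "is_eigenvalue L \<mu> \<longleftrightarrow> eigenvalue (complex_matrix L) \<mu>"

text \<open>Eigenvalues are counted with their algebraic multiplicity.\<close>

definition index_linear :: "('a::euclidean_space \<Rightarrow> 'a) \<Rightarrow> nat" where
  "index_linear L =
     (\<Sum>\<mu> | is_eigenvalue L \<mu> \<and> Re \<mu> < 0. Polynomial.order \<mu> (char_poly (complex_matrix L)))"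

subsection \<open>Families\<close>

text \<open>\<open>iter_deriv f [v\<^sub>1, \<dots>, v\<^sub>k] x\<close> is the value of the \<open>k\<close>-th derivative of \<open>f\<close> at \<open>x\<close> on
  \<open>v\<^sub>1, \<dots>, v\<^sub>k\<close>. On a finite-dimensional domain, all iterated directional derivatives are
  differentiable (hence continuous) exactly when \<open>f\<close> is infinitely often differentiable.\<close>

primrec iter_deriv ::
  "('a::real_normed_vector \<Rightarrow> 'b::real_normed_vector) \<Rightarrow> 'a list \<Rightarrow> 'a \<Rightarrow> 'b" where
  "iter_deriv f [] = f"
| "iter_deriv f (v # vs) = (\<lambda>x. frechet_derivative (iter_deriv f vs) (at x) v)"

definition smooth :: "('a::euclidean_space \<Rightarrow> 'b::real_normed_vector) \<Rightarrow> bool" where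
  "smooth f \<longleftrightarrow> (\<forall>vs x. iter_deriv f vs differentiable (at x))"

definition families ::
  "('g, 'm) monoid_scheme \<Rightarrow> ('g \<Rightarrow> 'a::euclidean_space \<Rightarrow> 'a) \<Rightarrow> ('a \<times> real \<Rightarrow> 'a) set" where
  "families G \<phi> = {f. smooth f \<and>
     (\<forall>g\<in>carrier G. \<forall>v l. f (\<phi> g v, l) = \<phi> g (f (v, l))) \<and>
     (\<exists>F. (\<forall>v l. f (v, l) = l *\<^sub>R v + F (v, l)) \<and>
          (\<forall>l. ((\<lambda>v. F (v, l)) has_derivative (\<lambda>_. 0)) (at 0)))}"

text \<open>Basic neighbourhoods for uniform convergence on \<open>K\<close> of the derivatives of order at most \<open>r\<close>.
  Taking \<open>norm v \<le> 1\<close> amounts to using the operator norm of the derivatives as multilinear maps.\<close>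

definition family_nhd ::
  "('g, 'm) monoid_scheme \<Rightarrow> ('g \<Rightarrow> 'a::euclidean_space \<Rightarrow> 'a) \<Rightarrow> nat \<Rightarrow>
    ('a \<times> real \<Rightarrow> 'a) \<Rightarrow> ('a \<times> real) set \<Rightarrow> real \<Rightarrow> ('a \<times> real \<Rightarrow> 'a) set" where
  "family_nhd G \<phi> r f K e = {h \<in> families G \<phi>. \<forall>p\<in>K. \<forall>vs.
     length vs \<le> r \<and> (\<forall>v\<in>set vs. norm v \<le> 1) \<longrightarrow>
       norm (iter_deriv h vs p - iter_deriv f vs p) < e}"

lemma family_nhd_mono:
  assumes "K' \<subseteq> K" "e \<le> e'"
  shows "family_nhd G \<phi> r f K e \<subseteq> family_nhd G \<phi> r f K' e'"
proof
  fix h assume h: "h \<in> family_nhd G \<phi> r f K e"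
  have "norm (iter_deriv h vs p - iter_deriv f vs p) < e'"
    if "p \<in> K'" "length vs \<le> r \<and> (\<forall>v\<in>set vs. norm v \<le> 1)" for p vs
  proof -
    have "p \<in> K" using that(1) assms(1) by blast
    then have "norm (iter_deriv h vs p - iter_deriv f vs p) < e"
      using h that(2) unfolding family_nhd_def by blast
    then show ?thesis using assms(2) by linarith
  qed
  then show "h \<in> family_nhd G \<phi> r f K' e'"
    using h unfolding family_nhd_def by blast
qed

definition family_topology ::
  "('g, 'm) monoid_scheme \<Rightarrow> ('g \<Rightarrow> 'a::euclidean_space \<Rightarrow> 'a) \<Rightarrow> nat \<Rightarrow>
    ('a \<times> real \<Rightarrow> 'a) topology" where
  "family_topology G \<phi> r = topology (\<lambda>U. U \<subseteq> families G \<phi> \<and>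
     (\<forall>f\<in>U. \<exists>K e. compact K \<and> e > 0 \<and> family_nhd G \<phi> r f K e \<subseteq> U))"

lemma openin_family_topology:
  "openin (family_topology G \<phi> r) U \<longleftrightarrow> U \<subseteq> families G \<phi> \<and>
     (\<forall>f\<in>U. \<exists>K e. compact K \<and> e > 0 \<and> family_nhd G \<phi> r f K e \<subseteq> U)"
proof -
  define P where "P = (\<lambda>U. U \<subseteq> families G \<phi> \<and>
     (\<forall>f\<in>U. \<exists>K e. compact K \<and> e > 0 \<and> family_nhd G \<phi> r f K e \<subseteq> U))"
  have "istopology P"
    unfolding istopology_def
  proof (intro conjI allI impI)
    fix S T assume S: "P S" and T: "P T"
    have "\<exists>K e. compact K \<and> e > 0 \<and> family_nhd G \<phi> r f K e \<subseteq> S \<inter> T"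
      if f: "f \<in> S" "f \<in> T" for f
    proof -
      obtain K e where K: "compact K" "e > 0" "family_nhd G \<phi> r f K e \<subseteq> S"
        using S f unfolding P_def by blast
      obtain K' e' where K': "compact K'" "e' > 0" "family_nhd G \<phi> r f K' e' \<subseteq> T"
        using T f unfolding P_def by blast
      have "family_nhd G \<phi> r f (K \<union> K') (min e e') \<subseteq> family_nhd G \<phi> r f K e"
        "family_nhd G \<phi> r f (K \<union> K') (min e e') \<subseteq> family_nhd G \<phi> r f K' e'"
        by (simp_all add: family_nhd_mono)
      then have "family_nhd G \<phi> r f (K \<union> K') (min e e') \<subseteq> S \<inter> T"
        using K(3) K'(3) by blast
      moreover have "compact (K \<union> K')" "min e e' > 0" using K K' by auto
      ultimately show ?thesis by blast
    qed
    then show "P (S \<inter> T)" using S unfolding P_def by blast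
  next
    fix \<K> assume K: "\<forall>S\<in>\<K>. P S"
    show "P (\<Union>\<K>)" unfolding P_def
    proof (intro conjI ballI)
      show "\<Union>\<K> \<subseteq> families G \<phi>" using K unfolding P_def by blast
      fix f assume "f \<in> \<Union>\<K>"
      then obtain S where S: "S \<in> \<K>" "f \<in> S" by auto
      have "P S" using K S(1) by blast
      then obtain C e where "compact C" "e > 0" "family_nhd G \<phi> r f C e \<subseteq> S"
        using S(2) unfolding P_def by blast
      moreover have "S \<subseteq> \<Union>\<K>" using S(1) by (rule Union_upper)
      ultimately show "\<exists>K e. compact K \<and> e > 0 \<and> family_nhd G \<phi> r f K e \<subseteq> \<Union>\<K>"
        by (meson order_trans)
    qed
  qed
  then have "openin (topology P) U = P U" by (simp add: topology_inverse')
  then show ?thesis unfolding family_topology_def P_def .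
qed

subsection \<open>Zeros\<close>

definition state_derivative :: "('a::euclidean_space \<times> real \<Rightarrow> 'a) \<Rightarrow> 'a \<times> real \<Rightarrow> 'a \<Rightarrow> 'a" where
  "state_derivative f p = frechet_derivative (\<lambda>v. f (v, snd p)) (at (fst p))"

definition hyperbolic_zero :: "('a::euclidean_space \<times> real \<Rightarrow> 'a) \<Rightarrow> 'a \<times> real \<Rightarrow> bool" where
  "hyperbolic_zero f p \<longleftrightarrow>
     f p = 0 \<and> (\<forall>\<mu>. is_eigenvalue (state_derivative f p) \<mu> \<longrightarrow> Re \<mu> \<noteq> 0)"

definition zero_index :: "('a::euclidean_space \<times> real \<Rightarrow> 'a) \<Rightarrow> 'a \<times> real \<Rightarrow> nat" where
  "zero_index f p = index_linear (state_derivative f p)"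

definition hyperbolic_saddle :: "('a::euclidean_space \<times> real \<Rightarrow> 'a) \<Rightarrow> 'a \<times> real \<Rightarrow> bool" where
  "hyperbolic_saddle f p \<longleftrightarrow>
     hyperbolic_zero f p \<and> zero_index f p \<noteq> 0 \<and> zero_index f p \<noteq> DIM('a)"

definition hyperbolic_sink :: "('a::euclidean_space \<times> real \<Rightarrow> 'a) \<Rightarrow> 'a \<times> real \<Rightarrow> bool" where
  "hyperbolic_sink f p \<longleftrightarrow> hyperbolic_zero f p \<and> zero_index f p = DIM('a)"

definition hyperbolic_source :: "('a::euclidean_space \<times> real \<Rightarrow> 'a) \<Rightarrow> 'a \<times> real \<Rightarrow> bool" where
  "hyperbolic_source f p \<longleftrightarrow> hyperbolic_zero f p \<and> zero_index f p = 0"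

subsection \<open>Solution branches\<close>

text \<open>Continuously differentiable on \<open>S\<close>, with one-sided derivatives at the end points of an
  interval (the library's \<open>C1_differentiable_on\<close> uses two-sided derivatives).\<close>

definition C1_on :: "real set \<Rightarrow> (real \<Rightarrow> 'b::real_normed_vector) \<Rightarrow> bool" where
  "C1_on S \<gamma> \<longleftrightarrow> (\<exists>\<gamma>'. (\<forall>s\<in>S. (\<gamma> has_vector_derivative \<gamma>' s) (at s within S)) \<and> continuous_on S \<gamma>')"

text \<open>On a compact interval an injective immersion is automatically a homeomorphism onto its image.\<close>

definition C1_embedding_on :: "real set \<Rightarrow> (real \<Rightarrow> 'b::real_normed_vector) \<Rightarrow> bool" where
  "C1_embedding_on S \<gamma> \<longleftrightarrow>
     (\<exists>\<gamma>'. (\<forall>s\<in>S. (\<gamma> has_vector_derivative \<gamma>' s) (at s within S) \<and> \<gamma>' s \<noteq> 0) \<and>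
           continuous_on S \<gamma>') \<and>
     inj_on \<gamma> S"

definition solution_branch_on ::
  "('a::euclidean_space \<times> real \<Rightarrow> 'a) \<Rightarrow> real \<Rightarrow> (real \<Rightarrow> 'a \<times> real) \<Rightarrow> bool" where
  "solution_branch_on f \<delta> \<gamma> \<longleftrightarrow>
     \<delta> > 0 \<and> C1_embedding_on {0..\<delta>} \<gamma> \<and> \<gamma> 0 = (0, 0) \<and> (\<forall>s\<in>{0..\<delta>}. f (\<gamma> s) = 0)"

text \<open>A branch is represented by a function on \<open>\<real>\<close> of which only the values on some interval
  \<open>[0, \<delta>]\<close> matter: all notions below depend only on the germ at \<open>0\<close> from the right.\<close>

definition branches :: "('a::euclidean_space \<times> real \<Rightarrow> 'a) \<Rightarrow> (real \<Rightarrow> 'a \<times> real) set" where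
  "branches f = {\<gamma>. \<exists>\<delta>. solution_branch_on f \<delta> \<gamma>}"

text \<open>For a family in \<open>families G \<phi>\<close> with \<open>G\<close> acting irreducibly and non-trivially, \<open>x\<close> vanishes
  either identically or nowhere on \<open>(0, \<delta>]\<close>, by the implicit function theorem along \<open>x = 0\<close>.\<close>

definition nontrivial_branches :: "('a::euclidean_space \<times> real \<Rightarrow> 'a) \<Rightarrow> (real \<Rightarrow> 'a \<times> real) set" where
  "nontrivial_branches f =
     {\<gamma>. \<exists>\<delta>. solution_branch_on f \<delta> \<gamma> \<and> \<not> (\<forall>s\<in>{0<..\<delta>}. fst (\<gamma> s) = 0)}"

definition forward_branch :: "(real \<Rightarrow> 'a \<times> real) \<Rightarrow> bool" where
  "forward_branch \<gamma> \<longleftrightarrow> (\<exists>\<delta>>0. \<forall>s\<in>{0<..\<delta>}. snd (\<gamma> s) > 0)"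

definition backward_branch :: "(real \<Rightarrow> 'a \<times> real) \<Rightarrow> bool" where
  "backward_branch \<gamma> \<longleftrightarrow> (\<exists>\<delta>>0. \<forall>s\<in>{0<..\<delta>}. snd (\<gamma> s) < 0)"

definition hyperbolic_branch ::
  "('a::euclidean_space \<times> real \<Rightarrow> 'a) \<Rightarrow> (real \<Rightarrow> 'a \<times> real) \<Rightarrow> bool" where
  "hyperbolic_branch f \<gamma> \<longleftrightarrow> (\<exists>\<delta>>0. \<forall>s\<in>{0<..\<delta>}. hyperbolic_zero f (\<gamma> s))"

definition equivalent_branches :: "(real \<Rightarrow> 'b) \<Rightarrow> (real \<Rightarrow> 'b) \<Rightarrow> bool" where
  "equivalent_branches \<gamma> \<rho> \<longleftrightarrow>
     (\<exists>\<epsilon>\<^sub>1>0. \<exists>\<epsilon>\<^sub>2>0. \<exists>\<alpha> \<beta>. homeomorphism {0..\<epsilon>\<^sub>1} {0..\<epsilon>\<^sub>2} \<alpha> \<beta> \<and>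
        C1_on {0..\<epsilon>\<^sub>1} \<alpha> \<and> C1_on {0..\<epsilon>\<^sub>2} \<beta> \<and> \<alpha> 0 = 0 \<and>
        (\<exists>\<epsilon>>0. \<epsilon> \<le> \<epsilon>\<^sub>1 \<and> (\<forall>s\<in>{0..\<epsilon>}. \<gamma> (\<alpha> s) = \<rho> s)))"

definition branch_rel ::
  "('a::euclidean_space \<times> real \<Rightarrow> 'a) \<Rightarrow> ((real \<Rightarrow> 'a \<times> real) \<times> (real \<Rightarrow> 'a \<times> real)) set" where
  "branch_rel f = {(\<gamma>, \<rho>). \<gamma> \<in> branches f \<and> \<rho> \<in> branches f \<and> equivalent_branches \<gamma> \<rho>}"

definition Sigma_all :: "('a::euclidean_space \<times> real \<Rightarrow> 'a) \<Rightarrow> (real \<Rightarrow> 'a \<times> real) set set" where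
  "Sigma_all f = branches f // branch_rel f"

definition Sigma_star :: "('a::euclidean_space \<times> real \<Rightarrow> 'a) \<Rightarrow> (real \<Rightarrow> 'a \<times> real) set set" where
  "Sigma_star f = nontrivial_branches f // branch_rel f"

text \<open>The action of a group element, acting by \<open>\<phi> g\<close> on the state space, on classes of branches.\<close>

definition act_class :: "('a \<Rightarrow> 'a) \<Rightarrow> (real \<Rightarrow> 'a \<times> real) set \<Rightarrow> (real \<Rightarrow> 'a \<times> real) set" where
  "act_class h c = (\<lambda>\<gamma> s. (h (fst (\<gamma> s)), snd (\<gamma> s))) ` c"

text \<open>Sign and index are only meaningful for classes of hyperbolic branches. There, the index is
  constant along a branch near \<open>0\<close> and every branch is either forward or backward.\<close>

definition class_index :: "('a::euclidean_space \<times> real \<Rightarrow> 'a) \<Rightarrow> (real \<Rightarrow> 'a \<times> real) set \<Rightarrow> nat" where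
  "class_index f c = (THE k. \<exists>\<gamma>\<in>c. \<exists>\<delta>>0. \<forall>s\<in>{0<..\<delta>}. zero_index f (\<gamma> s) = k)"

definition class_sgn :: "(real \<Rightarrow> 'a \<times> real) set \<Rightarrow> int" where
  "class_sgn c = (THE k. \<exists>\<gamma>\<in>c. forward_branch \<gamma> \<and> k = 1 \<or> backward_branch \<gamma> \<and> k = -1)"

definition finite_hyperbolic :: "('a::euclidean_space \<times> real \<Rightarrow> 'a) \<Rightarrow> bool" where
  "finite_hyperbolic f \<longleftrightarrow> finite (Sigma_all f) \<and> (\<forall>c\<in>Sigma_all f. \<forall>\<gamma>\<in>c. hyperbolic_branch f \<gamma>)"

definition Sigma_star_isomorphic ::
  "('g, 'm) monoid_scheme \<Rightarrow> ('g \<Rightarrow> 'a::euclidean_space \<Rightarrow> 'a) \<Rightarrow>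
    ('a \<times> real \<Rightarrow> 'a) \<Rightarrow> ('a \<times> real \<Rightarrow> 'a) \<Rightarrow> bool" where
  "Sigma_star_isomorphic G \<phi> f\<^sub>1 f\<^sub>2 \<longleftrightarrow>
     finite_hyperbolic f\<^sub>1 \<and> finite_hyperbolic f\<^sub>2 \<and>
     (\<exists>\<Phi>. bij_betw \<Phi> (Sigma_star f\<^sub>1) (Sigma_star f\<^sub>2) \<and>
          (\<forall>c\<in>Sigma_star f\<^sub>1.
             (\<forall>g\<in>carrier G. \<Phi> (act_class (\<phi> g) c) = act_class (\<phi> g) (\<Phi> c)) \<and>
             class_sgn (\<Phi> c) = class_sgn c \<and>
             class_index f\<^sub>2 (\<Phi> c) = class_index f\<^sub>1 c))"

subsection \<open>Stable families\<close>

text \<open>A continuous family of \<open>C\<^sup>1\<close> maps \<open>\<gamma>\<^sub>t\<close> is a jointly continuous map \<open>(t, s) \<mapsto> \<gamma>\<^sub>t s\<close> that is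
  \<open>C\<^sup>1\<close> in \<open>s\<close>; differentiability is contained in \<open>solution_branch_on\<close>.\<close>

definition stable_families ::
  "('g, 'm) monoid_scheme \<Rightarrow> ('g \<Rightarrow> 'a::euclidean_space \<Rightarrow> 'a) \<Rightarrow> ('a \<times> real \<Rightarrow> 'a) set" where
  "stable_families G \<phi> = {f \<in> families G \<phi>.
     finite_hyperbolic f \<and>
     (\<exists>r\<ge>1. \<exists>U \<subseteq> families G \<phi>. f \<in> (family_topology G \<phi> r) interior_of U \<and>
       (\<forall>ft. continuous_map (top_of_set {0..1::real}) (subtopology (family_topology G \<phi> r) U) ft \<and>
             ft 0 = f \<longrightarrow>
          (\<exists>\<delta>>0. \<forall>c\<in>Sigma_all f. \<exists>\<Gamma>.
             continuous_on ({0..1} \<times> {0..\<delta>}) (\<lambda>(t, s). \<Gamma> t s) \<and>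
             (\<forall>t\<in>{0..1}. solution_branch_on (ft t) \<delta> (\<Gamma> t) \<and>
                         (\<forall>s\<in>{0<..\<delta>}. hyperbolic_zero (ft t) (\<Gamma> t s))) \<and>
             \<Gamma> 0 \<in> c) \<and>
          (\<forall>t\<in>{0..1}. Sigma_star_isomorphic G \<phi> f (ft t))))}"

subsection \<open>Quadratic equivariants\<close>

definition quadratic_equivariants ::
  "('g, 'm) monoid_scheme \<Rightarrow> ('g \<Rightarrow> 'a::euclidean_space \<Rightarrow> 'a) \<Rightarrow> ('a \<Rightarrow> 'a) set" where
  "quadratic_equivariants G \<phi> =
     {Q. (\<exists>B. bilinear B \<and> (\<forall>v. Q v = B v v)) \<and> equivariant G \<phi> Q}"

definition has_quadratic_equivariants ::
  "('g, 'm) monoid_scheme \<Rightarrow> ('g \<Rightarrow> 'a::euclidean_space \<Rightarrow> 'a) \<Rightarrow> bool" where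
  "has_quadratic_equivariants G \<phi> \<longleftrightarrow> quadratic_equivariants G \<phi> \<noteq> {\<lambda>_. 0}"

text \<open>The topology of the finite-dimensional vector space of quadratic equivariants, given by the
  norm \<open>Q \<mapsto> sup {norm (Q u) | norm u = 1}\<close>.\<close>

definition quadratic_topology ::
  "('g, 'm) monoid_scheme \<Rightarrow> ('g \<Rightarrow> 'a::euclidean_space \<Rightarrow> 'a) \<Rightarrow> ('a \<Rightarrow> 'a) topology" where
  "quadratic_topology G \<phi> = topology (\<lambda>A. A \<subseteq> quadratic_equivariants G \<phi> \<and>
     (\<forall>Q\<in>A. \<exists>e>0. \<forall>R\<in>quadratic_equivariants G \<phi>.
        (\<forall>u\<in>sphere 0 1. norm (R u - Q u) < e) \<longrightarrow> R \<in> A))"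

lemma openin_quadratic_topology:
  "openin (quadratic_topology G \<phi>) A \<longleftrightarrow> A \<subseteq> quadratic_equivariants G \<phi> \<and>
     (\<forall>Q\<in>A. \<exists>e>0. \<forall>R\<in>quadratic_equivariants G \<phi>.
        (\<forall>u\<in>sphere 0 1. norm (R u - Q u) < e) \<longrightarrow> R \<in> A)"
proof -
  define P where "P = (\<lambda>A. A \<subseteq> quadratic_equivariants G \<phi> \<and>
     (\<forall>Q\<in>A. \<exists>e>0. \<forall>R\<in>quadratic_equivariants G \<phi>.
        (\<forall>u\<in>sphere 0 1. norm (R u - Q u) < e) \<longrightarrow> R \<in> A))"
  have "istopology P"
    unfolding istopology_def
  proof (intro conjI allI impI)
    fix S T assume S: "P S" and T: "P T"
    have "\<exists>e>0. \<forall>R\<in>quadratic_equivariants G \<phi>.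
        (\<forall>u\<in>sphere 0 1. norm (R u - Q u) < e) \<longrightarrow> R \<in> S \<inter> T"
      if Q: "Q \<in> S" "Q \<in> T" for Q
    proof -
      obtain e where e: "e > 0" "\<forall>R\<in>quadratic_equivariants G \<phi>.
          (\<forall>u\<in>sphere 0 1. norm (R u - Q u) < e) \<longrightarrow> R \<in> S"
        using S Q unfolding P_def by blast
      obtain e' where e': "e' > 0" "\<forall>R\<in>quadratic_equivariants G \<phi>.
          (\<forall>u\<in>sphere 0 1. norm (R u - Q u) < e') \<longrightarrow> R \<in> T"
        using T Q unfolding P_def by blast
      show ?thesis
        using e e' by (intro exI[of _ "min e e'"]) auto
    qed
    then show "P (S \<inter> T)" using S unfolding P_def by blast
  next
    fix \<K> assume K: "\<forall>S\<in>\<K>. P S"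
    show "P (\<Union>\<K>)" unfolding P_def
    proof (intro conjI ballI)
      show "\<Union>\<K> \<subseteq> quadratic_equivariants G \<phi>" using K unfolding P_def by blast
      fix Q assume "Q \<in> \<Union>\<K>"
      then obtain S where S: "S \<in> \<K>" "Q \<in> S" by blast
      have "P S" using K S(1) by blast
      then obtain e where "e > 0" "\<forall>R\<in>quadratic_equivariants G \<phi>.
          (\<forall>u\<in>sphere 0 1. norm (R u - Q u) < e) \<longrightarrow> R \<in> S"
        using S(2) unfolding P_def by blast
      then show "\<exists>e>0. \<forall>R\<in>quadratic_equivariants G \<phi>.
          (\<forall>u\<in>sphere 0 1. norm (R u - Q u) < e) \<longrightarrow> R \<in> \<Union>\<K>"
        using S by blast
    qed
  qed
  then have "openin (topology P) A = P A" by (simp add: topology_inverse')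
  then show ?thesis unfolding quadratic_topology_def P_def .
qed

definition unit_zeros :: "('a::euclidean_space \<Rightarrow> 'a) \<Rightarrow> 'a set" where
  "unit_zeros Q = {u \<in> sphere 0 1. Q u = 0}"

definition Q_zero ::
  "('g, 'm) monoid_scheme \<Rightarrow> ('g \<Rightarrow> 'a::euclidean_space \<Rightarrow> 'a) \<Rightarrow> ('a \<Rightarrow> 'a) set" where
  "Q_zero G \<phi> = {Q \<in> quadratic_equivariants G \<phi>. Q \<noteq> (\<lambda>_. 0) \<and>
     (\<forall>u\<in>unit_zeros Q. \<exists>\<mu>. is_eigenvalue (frechet_derivative Q (at u)) \<mu> \<and> Re \<mu> \<noteq> 0)}"

definition property_G ::
  "('g, 'm) monoid_scheme \<Rightarrow> ('g \<Rightarrow> 'a::euclidean_space \<Rightarrow> 'a) \<Rightarrow> bool" where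
  "property_G G \<phi> \<longleftrightarrow>
     openin (quadratic_topology G \<phi>) (Q_zero G \<phi>) \<and>
     (quadratic_topology G \<phi>) closure_of (Q_zero G \<phi>) = quadratic_equivariants G \<phi>"

end

theory Submission
  imports Defs "Jordan_Normal_Form.Schur_Decomposition"
begin

text \<open>Let \<open>Q\<close> be the quadratic part at \<open>(0, 0)\<close> of a family \<open>f\<close>. A non-trivial branch \<open>(x, \<lambda>)\<close> has a tangent
  \<open>(u, \<mu>)\<close> with \<open>u \<noteq> 0\<close> and \<open>\<mu> u + Q u = 0\<close>, and the linearization along it, divided by the branch
  parameter, tends to \<open>A = \<mu> I + DQ\<^sub>u\<close>. By Euler's identity \<open>A u = - \<mu> u\<close>. The map \<open>v \<mapsto> tr DQ\<^sub>v\<close> is an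
  invariant linear functional, hence zero, so \<open>tr A = n \<mu>\<close>. If \<open>\<mu> \<noteq> 0\<close>, the eigenvalue \<open>- \<mu>\<close> and the sign
  of the trace force eigenvalues of \<open>A\<close> in both open half planes; if \<open>\<mu> = 0\<close> and \<open>Q\<close> lies in
  \<open>\<Q>\<^sub>0\<close>, so do the eigenvalue of \<open>DQ\<^sub>u\<close> off the imaginary axis and the vanishing trace. By
  continuity of eigenvalues the branch then consists of saddles. A stable family need not have its quadratic part in
  \<open>\<Q>\<^sub>0\<close>, but by density an arbitrarily small quadratic perturbation does, and stability preserves indices.\<close>

subsection \<open>Continuity of the roots of complex polynomials\<close>

text \<open>The limit \<open>A\<close> need not be hyperbolic: eigenvalues on the imaginary axis may
  move to either side along the branch, so the index of the branch cannot be read off from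
  \<open>A\<close>. One eigenvalue in each open half plane does persist, and this is exactly what
  the two bounds on the index need. Hence continuity of roots occurs in two forms: nearness to a
  single root, for the limit \<open>A\<close>, and the count in a half plane, which keeps the index
  constant along a hyperbolic branch. The count matters because \<open>class_index\<close> is a
  definite description, determined only once the index is known to be eventually constant and equal
  for equivalent branches. That \<open>u\<close> is nonzero rests on the shape of the Taylor
  remainder: since \<open>f\<close> vanishes on \<open>x = 0\<close>, it is small compared with
  \<open>norm (x, l) * norm x\<close>, not merely with the square of \<open>norm (x, l)\<close>, so
  the equation can be divided by \<open>norm x\<close>.\<close>

lemma tendsto_poly:
  fixes P :: "'b \<Rightarrow> complex poly"
  assumes lim: "\<And>i. ((\<lambda>k. Polynomial.coeff (P k) i) \<longlongrightarrow> Polynomial.coeff p i) F"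
    and deg: "\<And>k. Polynomial.degree (P k) \<le> n" and degp: "Polynomial.degree p \<le> n"
  shows "((\<lambda>k. poly (P k) a) \<longlongrightarrow> poly p a) F"
proof -
  have eq: "poly q a = (\<Sum>i\<le>n. Polynomial.coeff q i * a ^ i)" if "Polynomial.degree q \<le> n" for q :: "complex poly"
    unfolding poly_altdef using that
    by (intro sum.mono_neutral_left) (auto simp: coeff_eq_0)
  show ?thesis
    unfolding eq[OF deg] eq[OF degp] by (intro tendsto_intros lim)
qed

lemma degree_prod_linear [simp]:
  "Polynomial.degree (\<Prod>a\<leftarrow>as. [:- a, 1:] :: complex poly) = length as"
  by (rule degree_linear_factors)

lemma poly_prod_linear_eq_0:
  "poly (\<Prod>a\<leftarrow>as. [:- a, 1:] :: complex poly) z = 0 \<longleftrightarrow> z \<in> set as"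
  by (induction as) auto

text \<open>If every root stays at distance at least \<open>e\<close> from \<open>b\<close>, the
  monic product has absolute value at least \<open>e ^ n\<close> at \<open>b\<close>; but its values
  there tend to that of the limit, which is 0.\<close>

lemma eventually_root_near:
  fixes as :: "'b \<Rightarrow> complex list"
  assumes lim: "\<And>i. ((\<lambda>k. Polynomial.coeff (\<Prod>a\<leftarrow>as k. [:- a, 1:]) i) \<longlongrightarrow>
      Polynomial.coeff (\<Prod>a\<leftarrow>bs. [:- a, 1:]) i) F"
    and len: "\<And>k. length (as k) = n" "length bs = n"
    and b: "b \<in> set bs" and e: "e > 0"
  shows "\<forall>\<^sub>F k in F. \<exists>a\<in>set (as k). dist a b < e"
proof -
  have "((\<lambda>k. poly (\<Prod>a\<leftarrow>as k. [:- a, 1:]) b) \<longlongrightarrow> poly (\<Prod>a\<leftarrow>bs. [:- a, 1:]) b) F"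
    by (rule tendsto_poly[OF lim, of n]) (simp_all add: len)
  then have "((\<lambda>k. poly (\<Prod>a\<leftarrow>as k. [:- a, 1:]) b) \<longlongrightarrow> 0) F"
    using b poly_prod_linear_eq_0 by metis
  then have "\<forall>\<^sub>F k in F. dist (poly (\<Prod>a\<leftarrow>as k. [:- a, 1:]) b) 0 < e ^ n"
    by (rule tendstoD) (use e in simp)
  then show ?thesis
  proof eventually_elim
    case (elim k)
    have "e ^ length xs \<le> norm (poly (\<Prod>a\<leftarrow>xs. [:- a, 1:]) b)" if "\<forall>a\<in>set xs. e \<le> dist a b" for xs
      using that
    proof (induction xs)
      case (Cons x xs)
      have "e * e ^ length xs \<le> norm (b - x) * norm (poly (\<Prod>a\<leftarrow>xs. [:- a, 1:]) b)"
        using Cons e by (intro mult_mono) (auto simp: dist_norm norm_minus_commute)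
      also have "\<dots> = norm (poly (\<Prod>a\<leftarrow>x # xs. [:- a, 1:]) b)"
        unfolding norm_mult[symmetric] by (simp add: algebra_simps)
      finally show ?case by simp
    qed simp
    from this[of "as k"] show ?case
      using elim len(1)[of k] by (force simp: not_less)
  qed
qed

text \<open>Division by a linear factor is continuous. By synthetic division each coefficient of the
  quotient is computed from the next higher ones, so convergence descends from the degree bound
  \<open>m\<close>, above which all coefficients vanish.\<close>

lemma tendsto_coeff_linear_factor:
  fixes Q :: "'b \<Rightarrow> complex poly"
  assumes lim: "\<And>i. ((\<lambda>k. Polynomial.coeff ([:- a k, 1:] * Q k) i) \<longlongrightarrow> Polynomial.coeff ([:- b, 1:] * q) i) F"
    and a: "(a \<longlongrightarrow> b) F"
    and deg: "\<And>k. Polynomial.degree (Q k) \<le> m" "Polynomial.degree q \<le> m"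
  shows "((\<lambda>k. Polynomial.coeff (Q k) i) \<longlongrightarrow> Polynomial.coeff q i) F"
proof -
  \<comment> \<open>\<open>d\<close> bounds how far \<open>i\<close> lies below
    \<open>Suc m\<close>, the first index certain to carry a zero coefficient;
    \<open>d = Suc m\<close> reaches every \<open>i\<close>.\<close>
  have "((\<lambda>k. Polynomial.coeff (Q k) i) \<longlongrightarrow> Polynomial.coeff q i) F" if "Suc m \<le> i + d" for i d
    using that
  proof (induction d arbitrary: i)
    case 0
    then have "Polynomial.coeff (Q k) i = 0" "Polynomial.coeff q i = 0" for k
      using deg(1)[of k] deg(2) by (auto intro!: coeff_eq_0)
    then show ?case by simp
  next
    case (Suc d)
    have rec: "Polynomial.coeff r i = Polynomial.coeff ([:- c, 1:] * r) (Suc i) + c * Polynomial.coeff r (Suc i)"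
      for c and r :: "complex poly"
      by simp
    have "((\<lambda>k. Polynomial.coeff ([:- a k, 1:] * Q k) (Suc i) + a k * Polynomial.coeff (Q k) (Suc i))
        \<longlongrightarrow> Polynomial.coeff ([:- b, 1:] * q) (Suc i) + b * Polynomial.coeff q (Suc i)) F"
      using Suc by (intro tendsto_intros lim a) auto
    then show ?case unfolding rec[symmetric] .
  qed
  from this[of i "Suc m"] show ?thesis by simp
qed

text \<open>The lists carry no common order, so the roots are matched one at a time: the root
  nearest to \<open>b\<close> converges to \<open>b\<close>, and both are divided out. As
  \<open>Re b\<close> is nonzero, the matched root ends up on the same side of the imaginary
  axis.\<close>

lemma eventually_count_roots:
  fixes as :: "'b \<Rightarrow> complex list"
  assumes "\<And>i. ((\<lambda>k. Polynomial.coeff (\<Prod>a\<leftarrow>as k. [:- a, 1:]) i) \<longlongrightarrow>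
      Polynomial.coeff (\<Prod>a\<leftarrow>bs. [:- a, 1:]) i) F"
    and "\<And>k. length (as k) = length bs"
    and "\<And>b. b \<in> set bs \<Longrightarrow> Re b \<noteq> 0"
  shows "\<forall>\<^sub>F k in F. length (filter (\<lambda>a. Re a < 0) (as k)) = length (filter (\<lambda>a. Re a < 0) bs)"
  using assms
proof (induction bs arbitrary: as)
  case Nil
  then show ?case by simp
next
  case (Cons b bs)
  define near where "near k = (SOME a. a \<in> set (as k) \<and> (\<forall>c\<in>set (as k). dist a b \<le> dist c b))" for k
  have near: "near k \<in> set (as k) \<and> (\<forall>c\<in>set (as k). dist (near k) b \<le> dist c b)" for k
  proof -
    have "set (as k) \<noteq> {}" using Cons.prems(2)[of k] by auto
    then have "\<exists>a. a \<in> set (as k) \<and> (\<forall>c\<in>set (as k). dist a b \<le> dist c b)"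
      using ex_min_if_finite[of "(\<lambda>a. dist a b) ` set (as k)"] by (force simp: not_less)
    then show ?thesis unfolding near_def by (rule someI_ex)
  qed
  have lim: "(near \<longlongrightarrow> b) F"
  proof (rule tendstoI)
    fix e :: real assume "e > 0"
    then have "\<forall>\<^sub>F k in F. \<exists>a\<in>set (as k). dist a b < e"
      by (intro eventually_root_near[OF Cons.prems(1), of "length (b # bs)"]) (use Cons.prems(2) in auto)
    then show "\<forall>\<^sub>F k in F. dist (near k) b < e"
      by eventually_elim (use near in force)
  qed
  have split: "(\<Prod>a\<leftarrow>as k. [:- a, 1:]) = [:- near k, 1:] * (\<Prod>a\<leftarrow>remove1 (near k) (as k). [:- a, 1:])" for k
    by (rule prod_list_map_remove1) (use near in blast)
  have len: "length (remove1 (near k) (as k)) = length bs" for k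
    using near[of k] Cons.prems(2)[of k] by (simp add: length_remove1)
  have "\<forall>\<^sub>F k in F. length (filter (\<lambda>a. Re a < 0) (remove1 (near k) (as k))) = length (filter (\<lambda>a. Re a < 0) bs)"
  proof (rule Cons.IH)
    show "((\<lambda>k. Polynomial.coeff (\<Prod>a\<leftarrow>remove1 (near k) (as k). [:- a, 1:]) i) \<longlongrightarrow>
        Polynomial.coeff (\<Prod>a\<leftarrow>bs. [:- a, 1:]) i) F" for i
    proof (rule tendsto_coeff_linear_factor[where a = near and b = b and m = "length bs"])
      show "((\<lambda>k. Polynomial.coeff ([:- near k, 1:] * (\<Prod>a\<leftarrow>remove1 (near k) (as k). [:- a, 1:])) i) \<longlongrightarrow>
          Polynomial.coeff ([:- b, 1:] * (\<Prod>a\<leftarrow>bs. [:- a, 1:])) i) F" for i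
        using Cons.prems(1) by (simp only: split list.map prod_list.Cons)
    qed (simp_all add: lim len)
  qed (use len Cons.prems(3) in auto)
  moreover have "\<forall>\<^sub>F k in F. (Re (near k) < 0) = (Re b < 0)"
  proof (cases "Re b < 0")
    case True
    then have "\<forall>\<^sub>F k in F. Re (near k) < 0"
      using order_tendstoD(2)[OF tendsto_Re[OF lim]] by blast
    then show ?thesis by eventually_elim (use True in simp)
  next
    case False
    then have "\<forall>\<^sub>F k in F. Re (near k) > 0"
      using order_tendstoD(1)[OF tendsto_Re[OF lim], of 0] Cons.prems(3)[of b] by auto
    then show ?thesis by eventually_elim (use False in simp)
  qed
  ultimately show ?case
  proof eventually_elim
    case (elim k)
    have "length (filter P (remove1 x xs)) + (if P x then 1 else 0) = length (filter P xs)"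
      if "x \<in> set xs" for P and x :: complex and xs
      using that by (induction xs) auto
    from this[of "near k" "as k" "\<lambda>a. Re a < 0"] show ?case
      using elim near[of k] by auto
  qed
qed

section \<open>The index as a number of roots\<close>

lemma order_prod_linear:
  "Polynomial.order z (\<Prod>a\<leftarrow>as. [:- a, 1:] :: complex poly) = count_list as z"
proof (induction as)
  case (Cons a as)
  have "(\<Prod>a\<leftarrow>as. [:- a, 1:] :: complex poly) \<noteq> 0" by (auto simp: prod_list_zero_iff)
  then have "Polynomial.order z ([:- a, 1:] * (\<Prod>a\<leftarrow>as. [:- a, 1:])) =
    Polynomial.order z [:- a, 1:] + Polynomial.order z (\<Prod>a\<leftarrow>as. [:- a, 1:])"
    by (intro order_mult) (simp only: mult_eq_0_iff, simp)
  then show ?case using Cons by (auto simp: order_linear' order_linear)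
qed simp

lemma complex_matrix_carrier [simp]: 
  "complex_matrix (L :: 'a::euclidean_space \<Rightarrow> 'a) \<in> carrier_mat DIM('a) DIM('a)"
  by (simp add: complex_matrix_def)

text \<open>Algebraic multiplicity is multiplicity in the list of roots, so the sum of orders
  becomes the length of a filtered list, the form in which roots can be counted in the
  limit.\<close>

lemma index_linear_eq_length_filter:
  fixes L :: "'a::euclidean_space \<Rightarrow> 'a"
  assumes "char_poly (complex_matrix L) = (\<Prod>a\<leftarrow>as. [:- a, 1:])"
  shows "index_linear L = length (filter (\<lambda>a. Re a < 0) as)"
proof -
  have ev: "is_eigenvalue L z \<longleftrightarrow> z \<in> set as" for z
    unfolding is_eigenvalue_def eigenvalue_root_char_poly[OF complex_matrix_carrier] assms
    by (rule poly_prod_linear_eq_0)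
  have "index_linear L = (\<Sum>z | z \<in> set as \<and> Re z < 0. count_list as z)"
    unfolding index_linear_def ev assms order_prod_linear ..
  also have "\<dots> = (\<Sum>z\<in>set (filter (\<lambda>a. Re a < 0) as). count_list (filter (\<lambda>a. Re a < 0) as) z)"
  proof (rule sum.cong)
    fix z assume "z \<in> set (filter (\<lambda>a. Re a < 0) as)"
    then have "Re z < 0" by simp
    then show "count_list as z = count_list (filter (\<lambda>a. Re a < 0) as) z"
      by (induction as) auto
  qed auto
  also have "\<dots> = length (filter (\<lambda>a. Re a < 0) as)"
    by (rule sum_count_set) auto
  finally show ?thesis .
qed

section \<open>Continuity of the characteristic polynomial\<close>

lemma tendsto_coeff_mult:
  fixes P Q :: "'b \<Rightarrow> complex poly"
  assumes "\<And>i. ((\<lambda>k. Polynomial.coeff (P k) i) \<longlongrightarrow> Polynomial.coeff p i) F"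
    and "\<And>i. ((\<lambda>k. Polynomial.coeff (Q k) i) \<longlongrightarrow> Polynomial.coeff q i) F"
  shows "((\<lambda>k. Polynomial.coeff (P k * Q k) i) \<longlongrightarrow> Polynomial.coeff (p * q) i) F"
  unfolding coeff_mult by (intro tendsto_intros assms)

lemma tendsto_coeff_prod:
  fixes P :: "'c \<Rightarrow> 'b \<Rightarrow> complex poly"
  assumes "finite I"
    and "\<And>j i. j \<in> I \<Longrightarrow> ((\<lambda>k. Polynomial.coeff (P j k) i) \<longlongrightarrow> Polynomial.coeff (p j) i) F"
  shows "((\<lambda>k. Polynomial.coeff (\<Prod>j\<in>I. P j k) i) \<longlongrightarrow> Polynomial.coeff (\<Prod>j\<in>I. p j) i) F"
  using assms
proof (induction I arbitrary: i rule: finite_induct)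
  case (insert x I)
  then show ?case by (simp add: tendsto_coeff_mult)
qed simp

text \<open>By the Leibniz formula the coefficients are polynomials in the matrix entries.\<close>

lemma tendsto_coeff_char_poly:
  fixes A :: "'b \<Rightarrow> complex mat"
  assumes A: "\<And>k. A k \<in> carrier_mat n n" "B \<in> carrier_mat n n"
    and lim: "\<And>i j. i < n \<Longrightarrow> j < n \<Longrightarrow> ((\<lambda>k. A k $$ (i, j)) \<longlongrightarrow> B $$ (i, j)) F"
  shows "((\<lambda>k. Polynomial.coeff (char_poly (A k)) m) \<longlongrightarrow> Polynomial.coeff (char_poly B) m) F"
proof -
  have entry: "((\<lambda>k. Polynomial.coeff (char_poly_matrix (A k) $$ (i, j)) m) \<longlongrightarrow>
      Polynomial.coeff (char_poly_matrix B $$ (i, j)) m) F" if ij: "i < n" "j < n" for i j m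
  proof -
    have "char_poly_matrix C $$ (i, j) = (if i = j then [:0, 1:] else 0) + [:- (C $$ (i, j)):]"
      if "C \<in> carrier_mat n n" for C :: "complex mat"
      using ij that by (auto simp: char_poly_matrix_def)
    then show ?thesis using A lim[OF ij]
      by (cases m) (auto intro!: tendsto_intros)
  qed
  have C: "char_poly_matrix (A k) \<in> carrier_mat n n" "char_poly_matrix B \<in> carrier_mat n n" for k
    using A by auto
  have sgn: "((\<lambda>k. Polynomial.coeff (signof p) i) \<longlongrightarrow> Polynomial.coeff (signof p :: complex poly) i) F" for i p
    by simp
  show ?thesis
    unfolding char_poly_def det_def'[OF C(1)] det_def'[OF C(2)] coeff_sum
    by (intro tendsto_sum tendsto_coeff_mult tendsto_coeff_prod sgn entry)
      (auto dest: permutes_nat_less)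
qed

subsection \<open>Eigenvalues of linear maps\<close>

lemma trace_mult_commute:
  fixes A B :: "complex mat"
  assumes "A \<in> carrier_mat n n" "B \<in> carrier_mat n n"
  shows "(\<Sum>i<n. (A * B) $$ (i, i)) = (\<Sum>i<n. (B * A) $$ (i, i))"
proof -
  have "(\<Sum>i<n. (A * B) $$ (i, i)) = (\<Sum>i<n. \<Sum>j<n. A $$ (i, j) * B $$ (j, i))"
    using assms by (auto simp: scalar_prod_def atLeast0LessThan intro!: sum.cong)
  also have "\<dots> = (\<Sum>j<n. \<Sum>i<n. A $$ (i, j) * B $$ (j, i))"
    by (rule sum.swap)
  also have "\<dots> = (\<Sum>i<n. (B * A) $$ (i, i))"
    using assms by (auto simp: scalar_prod_def atLeast0LessThan mult.commute intro!: sum.cong)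
  finally show ?thesis .
qed

text \<open>The Schur form carries the list \<open>as\<close> on its diagonal, and cyclicity of the
  trace undoes the similarity.\<close>

lemma sum_roots_char_poly:
  fixes A :: "complex mat"
  assumes A: "A \<in> carrier_mat n n" and roots: "char_poly A = (\<Prod>a\<leftarrow>as. [:- a, 1:])"
  shows "sum_list as = (\<Sum>i<n. A $$ (i, i))"
proof -
  obtain B P Q where schur: "schur_decomposition A as = (B, P, Q)" by (metis prod_cases3)
  note B = schur_decomposition[OF A roots schur]
  note wit = similar_mat_witD2[OF A B(1)[THEN conjunct1]]
  have "(\<Sum>i<n. A $$ (i, i)) = (\<Sum>i<n. (P * (B * Q)) $$ (i, i))"
    using wit by (simp add: assoc_mult_mat[of P n n B n Q n])
  also have "\<dots> = (\<Sum>i<n. (B * Q * P) $$ (i, i))"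
    using wit by (intro trace_mult_commute) auto
  also have "B * Q * P = B"
    using wit by (simp add: assoc_mult_mat[of B n n Q n P n])
  also have "(\<Sum>i<n. B $$ (i, i)) = sum_list (diag_mat B)"
    using wit by (simp add: diag_mat_def interv_sum_list_conv_sum_set_nat atLeast0LessThan)
  also have "diag_mat B = as" using B by simp
  finally show ?thesis ..
qed

text \<open>All complex roots of the characteristic polynomial, repeated by algebraic multiplicity.
  Their order is arbitrary, so only quantities independent of it are meaningful.\<close>

definition eigenvalue_list :: "('a::euclidean_space \<Rightarrow> 'a) \<Rightarrow> complex list" where
  "eigenvalue_list L =
    (SOME as. char_poly (complex_matrix L) = (\<Prod>a\<leftarrow>as. [:- a, 1:]) \<and> length as = DIM('a))"

lemma eigenvalue_list:
  fixes L :: "'a::euclidean_space \<Rightarrow> 'a"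
  shows char_poly_eigenvalue_list: "char_poly (complex_matrix L) = (\<Prod>a\<leftarrow>eigenvalue_list L. [:- a, 1:])"
    and length_eigenvalue_list: "length (eigenvalue_list L) = DIM('a)"
  using someI_ex[OF char_poly_factorized[OF complex_matrix_carrier[of L]]]
  unfolding eigenvalue_list_def by auto

lemma is_eigenvalue_iff_list: "is_eigenvalue L z \<longleftrightarrow> z \<in> set (eigenvalue_list L)"
  unfolding is_eigenvalue_def eigenvalue_root_char_poly[OF complex_matrix_carrier]
    char_poly_eigenvalue_list by (rule poly_prod_linear_eq_0)

lemma index_linear_eq_length: 
  "index_linear L = length (filter (\<lambda>a. Re a < 0) (eigenvalue_list L))"
  by (rule index_linear_eq_length_filter) (rule char_poly_eigenvalue_list)

lemma index_linear_ge_1: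
  assumes "is_eigenvalue L z" "Re z < 0"
  shows "1 \<le> index_linear L"
proof -
  have "z \<in> set (filter (\<lambda>a. Re a < 0) (eigenvalue_list L))"
    using assms by (simp add: is_eigenvalue_iff_list)
  then show ?thesis unfolding index_linear_eq_length
    by (metis One_nat_def Suc_leI length_pos_if_in_set)
qed

lemma index_linear_less_DIM:
  fixes L :: "'a::euclidean_space \<Rightarrow> 'a"
  assumes "is_eigenvalue L z" "Re z > 0"
  shows "index_linear L < DIM('a)"
  unfolding index_linear_eq_length length_eigenvalue_list[of L, symmetric]
  by (rule length_filter_less[of z]) (use assms in \<open>simp_all add: is_eigenvalue_iff_list\<close>)

lemma sum_list_eigenvalue_list:
  fixes L :: "'a::euclidean_space \<Rightarrow> 'a"
  shows "sum_list (eigenvalue_list L) = of_real (\<Sum>b\<in>Basis. inner (L b) b)"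
proof -
  have "sum_list (eigenvalue_list L) = (\<Sum>i<DIM('a). complex_matrix L $$ (i, i))"
    by (rule sum_roots_char_poly[OF complex_matrix_carrier char_poly_eigenvalue_list])
  also have "\<dots> = of_real (\<Sum>i<DIM('a). inner (L (basis_list ! i)) (basis_list ! i))"
    by (simp add: complex_matrix_def)
  also have "(\<Sum>i<DIM('a). inner (L (basis_list ! i)) (basis_list ! i)) = (\<Sum>b\<in>Basis. inner (L b) b)"
    by (rule sum.reindex_bij_betw[of "\<lambda>i. basis_list ! i" _ _ "\<lambda>b. inner (L b) b"])
      (metis bij_betw_nth basis_list length_basis_list)
  finally show ?thesis .
qed

lemma complex_matrix_scaleR:
  "complex_matrix (\<lambda>v. c *\<^sub>R L v) = complex_of_real c \<cdot>\<^sub>m complex_matrix L"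
  by (rule eq_matI) (auto simp: complex_matrix_def)

lemma eigenvector_smult_mat:
  fixes A :: "complex mat"
  assumes A: "A \<in> carrier_mat n n" and v: "eigenvector A v z"
  shows "eigenvector (c \<cdot>\<^sub>m A) v (c * z)"
proof -
  have v': "v \<in> carrier_vec n" "v \<noteq> 0\<^sub>v n" "A *\<^sub>v v = z \<cdot>\<^sub>v v"
    using v A unfolding eigenvector_def by auto
  have "(c \<cdot>\<^sub>m A) *\<^sub>v v = c \<cdot>\<^sub>v (A *\<^sub>v v)"
  proof (rule eq_vecI)
    fix i assume "i < dim_vec (c \<cdot>\<^sub>v (A *\<^sub>v v))"
    then have i: "i < n" using A by simp
    then have "Matrix.row A i \<in> carrier_vec n" using A by auto
    from smult_scalar_prod_distrib[OF this v'(1), of c]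
    show "vec_index ((c \<cdot>\<^sub>m A) *\<^sub>v v) i = vec_index (c \<cdot>\<^sub>v (A *\<^sub>v v)) i"
      using A i by simp
  qed (use A in simp)
  also have "\<dots> = (c * z) \<cdot>\<^sub>v v" unfolding v'(3) by (rule smult_smult_assoc)
  finally show ?thesis using v' A unfolding eigenvector_def by simp
qed

text \<open>Used to return from the linearization divided by the branch parameter to the
  linearization itself; there \<open>c > 0\<close>, so signs of real parts are kept.\<close>

lemma is_eigenvalue_scaleR:
  assumes "is_eigenvalue L z"
  shows "is_eigenvalue (\<lambda>v. c *\<^sub>R L v) (of_real c * z)"
  using assms eigenvector_smult_mat[OF complex_matrix_carrier]
  unfolding is_eigenvalue_def eigenvalue_def complex_matrix_scaleR by blast

lemma is_eigenvalue_of_real: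
  fixes L :: "'a::euclidean_space \<Rightarrow> 'a"
  assumes "linear L" "L v = c *\<^sub>R v" "v \<noteq> 0"
  shows "is_eigenvalue L (of_real c)"
proof -
  let ?b = "\<lambda>i. basis_list ! i :: 'a"
  \<comment> \<open>The coordinates of \<open>v\<close> in the enumerated basis, read as a complex
    vector: the candidate eigenvector.\<close>
  define w where "w = Matrix.vec DIM('a) (\<lambda>i. complex_of_real (inner v (?b i)))"
  have bij: "bij_betw ?b {..<DIM('a)} Basis"
    by (metis bij_betw_nth basis_list length_basis_list)
  have rep: "L v = (\<Sum>j<DIM('a). inner v (?b j) *\<^sub>R L (?b j))"
  proof -
    have "L v = L (\<Sum>b\<in>Basis. inner v b *\<^sub>R b)" by (simp add: euclidean_representation)
    also have "\<dots> = (\<Sum>b\<in>Basis. inner v b *\<^sub>R L b)"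
      using assms(1) by (simp add: linear_sum linear_cmul)
    finally show ?thesis
      using sum.reindex_bij_betw[OF bij, of "\<lambda>b. inner v b *\<^sub>R L b"] by simp
  qed
  have "complex_matrix L *\<^sub>v w = of_real c \<cdot>\<^sub>v w"
  proof (rule eq_vecI)
    fix i assume "i < dim_vec (complex_of_real c \<cdot>\<^sub>v w)"
    then have i: "i < DIM('a)" by (simp add: w_def)
    have "vec_index (complex_matrix L *\<^sub>v w) i = of_real (\<Sum>j<DIM('a). inner (L (?b j)) (?b i) * inner v (?b j))"
      using i by (simp add: complex_matrix_def w_def scalar_prod_def atLeast0LessThan)
    also have "(\<Sum>j<DIM('a). inner (L (?b j)) (?b i) * inner v (?b j)) = inner (L v) (?b i)"
      unfolding rep by (simp add: inner_sum_left mult.commute)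
    also have "\<dots> = c * inner v (?b i)" by (simp add: assms(2))
    finally show "vec_index (complex_matrix L *\<^sub>v w) i = vec_index (complex_of_real c \<cdot>\<^sub>v w) i"
      using i by (simp add: w_def)
  qed (simp add: w_def complex_matrix_def)
  moreover have "w \<noteq> 0\<^sub>v DIM('a)"
  proof
    assume w: "w = 0\<^sub>v DIM('a)"
    have "inner v b = 0" if b: "b \<in> Basis" for b
    proof -
      have "b \<in> ?b ` {..<DIM('a)}" using b bij_betw_imp_surj_on[OF bij] by simp
      then obtain i where i: "i < DIM('a)" "b = ?b i"
        by blast
      have "vec_index w i = 0" using i w by simp
      then show ?thesis using i by (simp add: w_def)
    qed
    then have "v = 0" by (metis euclidean_eqI inner_zero_left)
    then show False using assms(3) by contradiction
  qed
  moreover have "dim_row (complex_matrix L) = DIM('a)" "w \<in> carrier_vec DIM('a)"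
    by (simp_all add: complex_matrix_def w_def)
  ultimately have "eigenvector (complex_matrix L) w (of_real c)"
    unfolding eigenvector_def by metis
  then show ?thesis
    unfolding is_eigenvalue_def eigenvalue_def by blast
qed

text \<open>Pointwise convergence suffices, since the matrix entries are coordinates of the images
  of finitely many basis vectors.\<close>

lemma tendsto_coeff_eigenvalue_list:
  fixes L :: "'b \<Rightarrow> 'a::euclidean_space \<Rightarrow> 'a"
  assumes "\<And>w. ((\<lambda>k. L k w) \<longlongrightarrow> M w) F"
  shows "((\<lambda>k. Polynomial.coeff (\<Prod>a\<leftarrow>eigenvalue_list (L k). [:- a, 1:]) i) \<longlongrightarrow>
      Polynomial.coeff (\<Prod>a\<leftarrow>eigenvalue_list M. [:- a, 1:]) i) F"
  unfolding char_poly_eigenvalue_list[symmetric]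
proof (rule tendsto_coeff_char_poly[OF complex_matrix_carrier complex_matrix_carrier])
  fix i j assume "i < DIM('a)" "j < DIM('a)"
  then show "((\<lambda>k. complex_matrix (L k) $$ (i, j)) \<longlongrightarrow> complex_matrix M $$ (i, j)) F"
    by (simp add: complex_matrix_def) (intro tendsto_intros assms)
qed

text \<open>\<open>M\<close> may have eigenvalues on the imaginary axis. In this form spectral
  information on the limit is carried back to the branch.\<close>

lemma eventually_eigenvalue_near:
  fixes L :: "'b \<Rightarrow> 'a::euclidean_space \<Rightarrow> 'a"
  assumes "\<And>w. ((\<lambda>k. L k w) \<longlongrightarrow> M w) F" and "is_eigenvalue M z" and "e > 0"
  shows "\<forall>\<^sub>F k in F. \<exists>z'. is_eigenvalue (L k) z' \<and> dist z' z < e"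
  using eventually_root_near[OF tendsto_coeff_eigenvalue_list[of L M F]
      length_eigenvalue_list length_eigenvalue_list, of z e] assms
  unfolding is_eigenvalue_iff_list by (simp add: Bex_def)

text \<open>Roots off the imaginary axis do not cross it under small changes. Applied at the points
  of a hyperbolic branch.\<close>

lemma eventually_index_linear_eq:
  fixes L :: "'b \<Rightarrow> 'a::euclidean_space \<Rightarrow> 'a"
  assumes "\<And>w. ((\<lambda>k. L k w) \<longlongrightarrow> M w) F" and "\<And>z. is_eigenvalue M z \<Longrightarrow> Re z \<noteq> 0"
  shows "\<forall>\<^sub>F k in F. index_linear (L k) = index_linear M"
  unfolding index_linear_eq_length
  by (rule eventually_count_roots[OF tendsto_coeff_eigenvalue_list])
    (use assms in \<open>simp_all add: length_eigenvalue_list is_eigenvalue_iff_list\<close>)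

text \<open>If all roots had real part of the sign of \<open>Re z\<close> (or \<open>0\<close>), so would the trace.\<close>

lemma eigenvalue_opposite_sign:
  assumes "is_eigenvalue L z" and "Re z * (\<Sum>b\<in>Basis. inner (L b) b) \<le> 0" and "Re z \<noteq> 0"
  shows "\<exists>z'. is_eigenvalue L z' \<and> Re z' * Re z < 0"
proof (rule ccontr)
  assume "\<not> ?thesis"
  then have nn: "0 \<le> Re x * Re z" if "x \<in> set (eigenvalue_list L)" for x
    using that by (auto simp: is_eigenvalue_iff_list not_less)
  have pos: "0 < (\<Sum>x\<leftarrow>xs. Re x * Re z)" if "z \<in> set xs" "\<And>x. x \<in> set xs \<Longrightarrow> 0 \<le> Re x * Re z" for xs
  proof -
    \<comment> \<open>The entry \<open>z\<close> alone contributes the strictly positive square of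
      its real part.\<close>
    have "(\<Sum>x\<leftarrow>xs. Re x * Re z) = Re z * Re z + (\<Sum>x\<leftarrow>remove1 z xs. Re x * Re z)"
      using that(1) by (rule sum_list_map_remove1)
    moreover have "0 \<le> (\<Sum>x\<leftarrow>remove1 z xs. Re x * Re z)"
      using that(2) by (intro sum_list_nonneg) (auto dest: notin_set_remove1[THEN contrapos_pp])
    moreover have "0 < Re z * Re z" using assms(3) by (simp add: zero_less_mult_iff) linarith
    ultimately show ?thesis by linarith
  qed
  have "Re (sum_list xs) = (\<Sum>x\<leftarrow>xs. Re x)" for xs by (induction xs) auto
  then have "(\<Sum>x\<leftarrow>eigenvalue_list L. Re x * Re z) = Re (sum_list (eigenvalue_list L)) * Re z"
    by (simp add: sum_list_mult_const)
  also have "\<dots> = Re z * (\<Sum>b\<in>Basis. inner (L b) b)"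
    by (simp add: sum_list_eigenvalue_list)
  finally show False
    using pos[of "eigenvalue_list L"] nn assms(1,2) by (simp add: is_eigenvalue_iff_list)
qed

subsection \<open>Invariant functionals and second derivatives\<close>

text \<open>The image of an orthonormal basis under \<open>f\<close> computes the same trace: expand
  \<open>L\<close> in \<open>Basis\<close>, move \<open>f\<close> across the inner products as its
  inverse, and resum.\<close>

lemma trace_orthogonal_transformation:
  fixes L f :: "'a::euclidean_space \<Rightarrow> 'a"
  assumes L: "linear L" and f: "orthogonal_transformation f"
  shows "(\<Sum>b\<in>Basis. inner (L (f b)) (f b)) = (\<Sum>b\<in>Basis. inner (L b) b)"
proof -
  obtain f' where f': "orthogonal_transformation f'" "\<And>x. f (f' x) = x"
    using f by (metis orthogonal_transformation_inv orthogonal_transformation_surj surj_f_inv_f)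
  have adj: "inner (f x) y = inner x (f' y)" for x y
    using f f' by (metis orthogonal_transformation_def)
  have rep: "L x = (\<Sum>c\<in>Basis. inner x c *\<^sub>R L c)" for x
    using linear_sum[OF L, of "\<lambda>c. inner x c *\<^sub>R c" Basis]
    by (simp add: euclidean_representation linear_cmul[OF L])
  have "(\<Sum>b\<in>Basis. inner (L (f b)) (f b)) = (\<Sum>b\<in>Basis. \<Sum>c\<in>Basis. inner (f b) c * inner (L c) (f b))"
    by (subst rep) (simp add: inner_sum_left)
  also have "\<dots> = (\<Sum>c\<in>Basis. \<Sum>b\<in>Basis. inner (f' c) b * inner (f' (L c)) b)"
    by (subst sum.swap) (simp add: adj inner_commute[of "L _"] inner_commute[of _ "f' _"])
  also have "\<dots> = (\<Sum>c\<in>Basis. inner (f' c) (f' (L c)))"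
    by (simp add: euclidean_inner[of "f' _" "f' _"])
  also have "\<dots> = (\<Sum>c\<in>Basis. inner (L c) c)"
    using f'(1) by (simp add: orthogonal_transformation_def inner_commute)
  finally show ?thesis .
qed

text \<open>The fixed vectors form an invariant subspace, which is not the whole space because the
  action is non-trivial. This is the source of both \<open>f (0, l) = 0\<close> and the vanishing of
  the trace.\<close>

lemma fixed_vector_eq_0:
  assumes irr: "absolutely_irreducible G \<phi>" and fix_v: "\<And>g. g \<in> carrier G \<Longrightarrow> \<phi> g v = v"
  shows "v = 0"
proof -
  let ?W = "{v. \<forall>g\<in>carrier G. \<phi> g v = v}"
  have lin: "linear (\<phi> g)" if "g \<in> carrier G" for g
    using irr that unfolding absolutely_irreducible_def orthogonal_representation_def
    by (auto intro: orthogonal_transformation_linear)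
  have "Real_Vector_Spaces.subspace ?W"
    unfolding Real_Vector_Spaces.subspace_def using lin by (auto simp: linear_0 linear_add linear_cmul)
  moreover have "\<forall>g\<in>carrier G. \<phi> g ` ?W \<subseteq> ?W" by auto
  moreover have "W = {0} \<or> W = UNIV"
    if "Real_Vector_Spaces.subspace W \<and> (\<forall>g\<in>carrier G. \<phi> g ` W \<subseteq> W)" for W
    using irr that unfolding absolutely_irreducible_def irreducible_representation_def by simp
  ultimately have "?W = {0} \<or> ?W = UNIV" by (metis (no_types, lifting))
  moreover obtain g w where "g \<in> carrier G" "\<phi> g w \<noteq> w"
    using irr unfolding absolutely_irreducible_def by auto
  then have "w \<notin> ?W" by blast
  then have "?W \<noteq> UNIV" by (metis UNIV_I)
  ultimately have "?W = {0}" by metis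
  moreover have "v \<in> ?W" using fix_v by simp
  ultimately show ?thesis by (metis singletonD)
qed

text \<open>Equivariance makes \<open>T\<close> an invariant linear functional; the vector
  \<open>a\<close> that represents it through the inner product is then fixed by the group.\<close>

lemma trace_bilinear_equivariant:
  fixes S :: "'a::euclidean_space \<Rightarrow> 'a \<Rightarrow> 'a"
  assumes irr: "absolutely_irreducible G \<phi>" and S: "bilinear S"
    and equiv: "\<And>g x y. g \<in> carrier G \<Longrightarrow> S (\<phi> g x) (\<phi> g y) = \<phi> g (S x y)"
  shows "(\<Sum>b\<in>Basis. inner (S v b) b) = 0"
proof -
  define T where "T x = (\<Sum>b\<in>Basis. inner (S x b) b)" for x
  define a where "a = (\<Sum>c\<in>Basis. T c *\<^sub>R c)"
  have lin: "linear (S x)" "linear (\<lambda>x. S x y)" for x y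
    using S unfolding bilinear_def by auto
  have linT: "linear T"
    unfolding T_def
    by (intro linear_compose_sum ballI linearI)
      (simp_all add: linear_add[OF lin(2)] linear_cmul[OF lin(2)] inner_add_left)
  have T: "T x = inner a x" for x
  proof -
    have "T x = T (\<Sum>c\<in>Basis. inner x c *\<^sub>R c)" by (simp add: euclidean_representation)
    also have "\<dots> = (\<Sum>c\<in>Basis. inner x c * T c)"
      by (simp add: linear_sum[OF linT] linear_cmul[OF linT])
    also have "\<dots> = inner a x"
      unfolding a_def inner_sum_left by (intro sum.cong) (simp_all add: inner_commute)
    finally show ?thesis .
  qed
  have "\<phi> g a = a" if g: "g \<in> carrier G" for g
  proof -
    have orth: "orthogonal_transformation (\<phi> g)"
      using irr g unfolding absolutely_irreducible_def orthogonal_representation_def by blast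
    obtain f' where f': "orthogonal_transformation f'" "\<And>x. \<phi> g (f' x) = x"
      using orth by (metis orthogonal_transformation_inv orthogonal_transformation_surj surj_f_inv_f)
    \<comment> \<open>\<open>S (\<phi> g x)\<close> is the conjugate of \<open>S x\<close> by the
      orthogonal map \<open>\<phi> g\<close>, and conjugation keeps the trace.\<close>
    have inv: "T (\<phi> g x) = T x" for x
    proof -
      have "inner (S (\<phi> g x) b) b = inner (S x (f' b)) (f' b)" for b
      proof -
        have "S (\<phi> g x) b = \<phi> g (S x (f' b))"
          using equiv[OF g, of x "f' b"] f'(2) by simp
        then have "inner (S (\<phi> g x) b) b = inner (\<phi> g (S x (f' b))) (\<phi> g (f' b))"
          using f'(2) by simp
        then show ?thesis using orth unfolding orthogonal_transformation_def by simp
      qed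
      then show ?thesis
        unfolding T_def using trace_orthogonal_transformation[OF lin(1) f'(1)] by simp
    qed
    have "inner (\<phi> g a) y = inner a y" for y
    proof -
      have "inner (\<phi> g a) y = inner a (f' y)"
        using orth f'(2) by (metis orthogonal_transformation_def)
      also have "\<dots> = inner a y" using inv[of "f' y"] f'(2) by (simp add: T)
      finally show ?thesis .
    qed
    then show ?thesis by (metis vector_eq_rdot)
  qed
  then have "a = 0" by (rule fixed_vector_eq_0[OF irr])
  then show ?thesis using T[of v] by (simp add: T_def)
qed

section \<open>Mean value estimates and symmetry of second derivatives\<close>

lemma norm_diff_le_vector_derivative:
  fixes m :: "real \<Rightarrow> 'a::real_normed_vector"
  assumes "0 \<le> t" and deriv: "\<And>\<tau>. (m has_vector_derivative m' \<tau>) (at \<tau>)"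
    and bound: "\<And>\<tau>. 0 \<le> \<tau> \<Longrightarrow> \<tau> \<le> t \<Longrightarrow> norm (m' \<tau>) \<le> B"
  shows "norm (m t - m 0) \<le> t * B"
proof (cases "t = 0")
  case False
  have "norm (m t - m 0) \<le> t * B - 0 * B"
  proof (rule differentiable_bound_general[where f' = m' and \<phi>' = "\<lambda>_. B"])
    show "continuous_on {0..t} m"
      using deriv by (meson continuous_at_imp_continuous_on has_vector_derivative_continuous)
  qed (use assms False in \<open>auto intro!: continuous_intros derivative_eq_intros simp: has_vector_derivative_def\<close>)
  then show ?thesis by simp
qed simp

lemma smooth_has_derivative:
  assumes "smooth f"
  shows "(iter_deriv f vs has_derivative (\<lambda>d. iter_deriv f (d # vs) p)) (at p)"
proof -
  have "iter_deriv f vs differentiable (at p)" using assms unfolding smooth_def by blast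
  then show ?thesis by (simp add: frechet_derivative_works)
qed

lemma smooth_has_vector_derivative_line:
  assumes "smooth f"
  shows "((\<lambda>\<tau>. iter_deriv f vs (p + \<tau> *\<^sub>R w)) has_vector_derivative iter_deriv f (w # vs) (p + \<tau> *\<^sub>R w)) (at \<tau>)"
proof -
  have "linear (\<lambda>d. iter_deriv f (d # vs) (p + \<tau> *\<^sub>R w))"
    using smooth_has_derivative[OF assms] by (rule has_derivative_linear)
  then have scale: "iter_deriv f ((h *\<^sub>R w) # vs) (p + \<tau> *\<^sub>R w) = h *\<^sub>R iter_deriv f (w # vs) (p + \<tau> *\<^sub>R w)" for h
    by (rule linear_cmul)
  have "((\<lambda>\<tau>. iter_deriv f vs (p + \<tau> *\<^sub>R w)) has_derivative
      (\<lambda>h. iter_deriv f ((h *\<^sub>R w) # vs) (p + \<tau> *\<^sub>R w))) (at \<tau>)"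
    by (rule has_derivative_compose[OF _ smooth_has_derivative[OF assms]])
      (auto intro!: derivative_eq_intros)
  then show ?thesis
    unfolding has_vector_derivative_def scale .
qed

text \<open>The second difference is the increment over \<open>[0, t]\<close> in the direction
  \<open>w\<close> of a first difference in the direction \<open>v\<close>. The rate of that
  increment is a difference of two values of the first derivative \<open>h\<close>, each of which is
  expanded at \<open>p\<close>.\<close>

lemma second_difference:
  assumes f: "smooth f" and e: "e > 0"
  shows "\<exists>\<delta>>0. \<forall>t. 0 < t \<and> t < \<delta> \<longrightarrow>
    norm (f (p + t *\<^sub>R v + t *\<^sub>R w) - f (p + t *\<^sub>R v) - f (p + t *\<^sub>R w) + f p - (t * t) *\<^sub>R iter_deriv f [v, w] p)
      \<le> e * (t * t)"
proof -
  define h where "h = iter_deriv f [w]"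
  define D where "D d = iter_deriv f [d, w] p" for d
  have hD: "(h has_derivative D) (at p)"
    using smooth_has_derivative[OF f, of "[w]"] unfolding h_def D_def .
  \<comment> \<open>The two points at which \<open>h\<close> is expanded lie within
    \<open>t * (norm v + norm w)\<close> of \<open>p\<close>, so the errors add up to at most
    \<open>e / N * (t * N)\<close>; the summand 1 keeps \<open>N\<close> positive when both vectors
    vanish.\<close>
  define N where "N = 2 * (norm v + norm w) + 1"
  have N: "N > 0" unfolding N_def by (simp add: add_nonneg_pos)
  obtain \<delta> where \<delta>: "\<delta> > 0"
    "\<And>y. norm (y - p) < \<delta> \<Longrightarrow> norm (h y - h p - D (y - p)) \<le> e / N * norm (y - p)"
    using hD e N unfolding has_derivative_at_alt by (meson divide_pos_pos)
  have linD: "linear D" using hD by (rule has_derivative_linear)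
  show ?thesis
  proof (intro exI[of _ "\<delta> / N"] conjI allI impI)
    show "\<delta> / N > 0" using \<delta>(1) N by simp
    fix t assume t: "0 < t \<and> t < \<delta> / N"
    have tN: "t * N < \<delta>" using t N by (simp add: pos_less_divide_eq)
    define m where "m \<tau> = f (p + t *\<^sub>R v + \<tau> *\<^sub>R w) - f (p + \<tau> *\<^sub>R w) - (\<tau> * t) *\<^sub>R D v" for \<tau>
    define m' where "m' \<tau> = h (p + t *\<^sub>R v + \<tau> *\<^sub>R w) - h (p + \<tau> *\<^sub>R w) - t *\<^sub>R D v" for \<tau>
    have "(m has_vector_derivative m' \<tau>) (at \<tau>)" for \<tau>
      unfolding m_def m'_def h_def
      using smooth_has_vector_derivative_line[OF f, of "[]"]
      by (intro has_vector_derivative_diff) (auto intro!: derivative_eq_intros simp: has_vector_derivative_def)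
    moreover have "norm (m' \<tau>) \<le> e * t" if \<tau>: "0 \<le> \<tau>" "\<tau> \<le> t" for \<tau>
    proof -
      define a where "a = t *\<^sub>R v + \<tau> *\<^sub>R w"
      define b where "b = \<tau> *\<^sub>R w"
      have "norm a \<le> t * norm v + \<tau> * norm w"
        unfolding a_def using t \<tau> by (intro order_trans[OF norm_triangle_ineq]) simp
      then have a: "norm a \<le> t * (norm v + norm w)"
        using mult_right_mono[OF \<tau>(2), of "norm w"] by (simp add: distrib_left)
      have b: "norm b \<le> t * (norm v + norm w)"
        unfolding b_def using mult_right_mono[OF \<tau>(2), of "norm w"] t \<tau> by (simp add: distrib_left add_increasing)
      have small: "t * (norm v + norm w) < \<delta>"
      proof -
        have "t * (norm v + norm w) \<le> t * N"
          using t unfolding N_def by (intro mult_left_mono) (smt (verit) norm_ge_zero, simp)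
        then show ?thesis using tN by linarith
      qed
      have ha: "norm (h (p + a) - h p - D a) \<le> e / N * norm a"
        using \<delta>(2)[of "p + a"] a small by simp
      have hb: "norm (h (p + b) - h p - D b) \<le> e / N * norm b"
        using \<delta>(2)[of "p + b"] b small by simp
      have "m' \<tau> = (h (p + a) - h p - D a) - (h (p + b) - h p - D b)"
        unfolding m'_def a_def b_def using linD by (simp add: linear_add linear_cmul add.assoc)
      then have "norm (m' \<tau>) \<le> e / N * norm a + e / N * norm b"
        using norm_triangle_ineq4 ha hb by (smt (verit))
      also have "\<dots> = e / N * (norm a + norm b)" by (simp add: distrib_left)
      also have "\<dots> \<le> e / N * (t * N)"
        using a b e N t by (intro mult_left_mono) (auto simp: N_def distrib_left)
      also have "\<dots> = e * t" using N by simp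
      finally show ?thesis .
    qed
    ultimately have "norm (m t - m 0) \<le> t * (e * t)"
      using norm_diff_le_vector_derivative[of t m m' "e * t"] t by simp
    then show "norm (f (p + t *\<^sub>R v + t *\<^sub>R w) - f (p + t *\<^sub>R v) - f (p + t *\<^sub>R w) + f p - (t * t) *\<^sub>R iter_deriv f [v, w] p)
      \<le> e * (t * t)"
      unfolding m_def D_def by (simp add: algebra_simps)
  qed
qed

text \<open>The second difference is symmetric in \<open>v\<close> and \<open>w\<close>, while its
  quotients by \<open>t * t\<close> approximate both iterated derivatives.\<close>

lemma iter_deriv_symmetric:
  assumes f: "smooth f"
  shows "iter_deriv f [v, w] p = iter_deriv f [w, v] p"
proof (rule ccontr)
  define A where "A = iter_deriv f [v, w] p"
  define B where "B = iter_deriv f [w, v] p"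
  assume "\<not> ?thesis"
  then have pos: "norm (A - B) > 0" by (simp add: A_def B_def del: iter_deriv.simps)
  \<comment> \<open>The two approximation errors add up to \<open>2 * e\<close>, which is half of
    \<open>norm (A - B)\<close>.\<close>
  define e where "e = norm (A - B) / 4"
  have e: "e > 0" unfolding e_def using pos by linarith
  obtain d1 where d1: "d1 > 0" "\<And>t. 0 < t \<Longrightarrow> t < d1 \<Longrightarrow>
    norm (f (p + t *\<^sub>R v + t *\<^sub>R w) - f (p + t *\<^sub>R v) - f (p + t *\<^sub>R w) + f p - (t * t) *\<^sub>R A) \<le> e * (t * t)"
    using second_difference[OF f e, of p v w] unfolding A_def by blast
  obtain d2 where d2: "d2 > 0" "\<And>t. 0 < t \<Longrightarrow> t < d2 \<Longrightarrow>
    norm (f (p + t *\<^sub>R w + t *\<^sub>R v) - f (p + t *\<^sub>R w) - f (p + t *\<^sub>R v) + f p - (t * t) *\<^sub>R B) \<le> e * (t * t)"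
    using second_difference[OF f e, of p w v] unfolding B_def by blast
  define t where "t = min d1 d2 / 2"
  have t: "0 < t" "t < d1" "t < d2" using d1(1) d2(1) by (auto simp: t_def)
  define X where "X = f (p + t *\<^sub>R v + t *\<^sub>R w) - f (p + t *\<^sub>R v) - f (p + t *\<^sub>R w) + f p"
  have "norm (X - (t * t) *\<^sub>R A) \<le> e * (t * t)" using d1(2)[OF t(1,2)] X_def by simp
  moreover have "norm (X - (t * t) *\<^sub>R B) \<le> e * (t * t)"
    using d2(2)[OF t(1,3)] by (simp add: X_def algebra_simps)
  ultimately have "norm ((X - (t * t) *\<^sub>R B) - (X - (t * t) *\<^sub>R A)) \<le> 2 * e * (t * t)"
    using norm_triangle_ineq4[of "X - (t * t) *\<^sub>R B" "X - (t * t) *\<^sub>R A"] by linarith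
  also have "(X - (t * t) *\<^sub>R B) - (X - (t * t) *\<^sub>R A) = (t * t) *\<^sub>R (A - B)"
    by (simp add: algebra_simps)
  finally have "(t * t) * norm (A - B) \<le> 2 * e * (t * t)" using t by simp
  then have "norm (A - B) \<le> 2 * e" using t by (simp add: mult.commute)
  then show False using pos by (simp add: e_def)
qed

lemma linear_iter_deriv_hd:
  assumes "smooth f"
  shows "linear (\<lambda>d. iter_deriv f (d # vs) p)"
  using smooth_has_derivative[OF assms] by (rule has_derivative_linear)

text \<open>In finite dimension, smallness on the basis vectors gives smallness in operator norm.
  This makes the Taylor remainders below uniform in the direction \<open>w\<close>.\<close>

lemma eventually_linear_uniform:
  fixes L :: "'b \<Rightarrow> 'a::euclidean_space \<Rightarrow> 'c::real_normed_vector"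
  assumes lin: "\<And>p. linear (L p)" and lim: "\<And>b. b \<in> Basis \<Longrightarrow> ((\<lambda>p. L p b) \<longlongrightarrow> 0) F" and e: "e > 0"
  shows "\<forall>\<^sub>F p in F. \<forall>w. norm (L p w) \<le> e * norm w"
proof -
  have "\<forall>\<^sub>F p in F. \<forall>b\<in>Basis. norm (L p b) < e / DIM('a)"
    using lim e by (intro eventually_ball_finite ballI) (auto simp: tendsto_iff)
  then show ?thesis
  proof eventually_elim
    case (elim p)
    show ?case
    proof
      fix w
      have "L p w = (\<Sum>b\<in>Basis. inner w b *\<^sub>R L p b)"
        using linear_sum[OF lin, of p "\<lambda>b. inner w b *\<^sub>R b" Basis]
        by (simp add: euclidean_representation linear_cmul[OF lin])
      then have "norm (L p w) \<le> (\<Sum>b\<in>Basis. \<bar>inner w b\<bar> * norm (L p b))"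
        by (metis (no_types, lifting) norm_scaleR norm_sum sum.cong)
      also have "\<dots> \<le> (\<Sum>b\<in>(Basis :: 'a set). norm w * (e / DIM('a)))"
        using elim by (intro sum_mono mult_mono) (auto simp: Basis_le_norm less_imp_le)
      also have "\<dots> = e * norm w" by simp
      finally show "norm (L p w) \<le> e * norm w" .
    qed
  qed
qed

subsection \<open>Expansion of families at the origin\<close>

lemma families_smooth: "f \<in> families G \<phi> \<Longrightarrow> smooth f"
  by (simp add: families_def)

lemma families_equivariant:
  "f \<in> families G \<phi> \<Longrightarrow> g \<in> carrier G \<Longrightarrow> f (\<phi> g v, l) = \<phi> g (f (v, l))"
  by (simp add: families_def)

lemma linear_action:
  "absolutely_irreducible G \<phi> \<Longrightarrow> g \<in> carrier G \<Longrightarrow> linear (\<phi> g)"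
  unfolding absolutely_irreducible_def orthogonal_representation_def
  by (auto intro: orthogonal_transformation_linear)

text \<open>The origin is fixed by the linear action, so its image is a fixed vector.\<close>

lemma families_zero:
  assumes "absolutely_irreducible G \<phi>" and f: "f \<in> families G \<phi>"
  shows "f (0, l) = 0"
proof (rule fixed_vector_eq_0[OF assms(1)])
  fix g assume g: "g \<in> carrier G"
  show "\<phi> g (f (0, l)) = f (0, l)"
    using families_equivariant[OF f g, of 0 l] linear_action[OF assms(1) g] by (simp add: linear_0)
qed

lemma smooth_state_has_derivative:
  assumes "smooth f"
  shows "((\<lambda>v. f (v, l)) has_derivative (\<lambda>w. iter_deriv f [(w, 0)] (x, l))) (at x)"
proof -
  have "((\<lambda>v. (v, l)) has_derivative (\<lambda>w. (w, 0))) (at x)"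
    by (auto intro!: derivative_eq_intros)
  from has_derivative_compose[OF this smooth_has_derivative[OF assms, of "[]"]]
  show ?thesis by (simp add: o_def)
qed

lemma state_derivative_eq:
  assumes "smooth f"
  shows "state_derivative f p = (\<lambda>w. iter_deriv f [(w, 0)] p)"
  unfolding state_derivative_def
  using frechet_derivative_at[OF smooth_state_has_derivative[OF assms, of "snd p" "fst p"]] by simp

lemma families_derivative_zero:
  assumes "f \<in> families G \<phi>"
  shows "iter_deriv f [(w, 0)] (0, l) = l *\<^sub>R w"
proof -
  obtain F where F: "\<And>v l. f (v, l) = l *\<^sub>R v + F (v, l)"
    "((\<lambda>v. F (v, l)) has_derivative (\<lambda>_. 0)) (at 0)"
    using assms unfolding families_def by blast
  have "((\<lambda>v. l *\<^sub>R v + F (v, l)) has_derivative (\<lambda>w. l *\<^sub>R w + 0)) (at 0)"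
    by (intro has_derivative_add F) (auto intro!: derivative_eq_intros)
  then have "((\<lambda>v. f (v, l)) has_derivative (\<lambda>w. l *\<^sub>R w)) (at 0)"
    by (simp add: F(1))
  from has_derivative_unique[OF this smooth_state_has_derivative[OF families_smooth[OF assms]]]
  show ?thesis by metis
qed

text \<open>The Hessian at the origin in the state directions. On the diagonal it is twice the
  quadratic part of \<open>f\<close>, whence the factors 1/2 below.\<close>

definition second_state_derivative :: "('a::euclidean_space \<times> real \<Rightarrow> 'a) \<Rightarrow> 'a \<Rightarrow> 'a \<Rightarrow> 'a" where
  "second_state_derivative f x w = iter_deriv f [(x, 0), (w, 0)] (0, 0)"

lemma second_state_derivative_commute:
  "smooth f \<Longrightarrow> second_state_derivative f x w = second_state_derivative f w x"
  unfolding second_state_derivative_def by (rule iter_deriv_symmetric)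

lemma linear_second_state_derivative:
  assumes "smooth f"
  shows "linear (\<lambda>x. second_state_derivative f x w)"
proof -
  have "linear ((\<lambda>d. iter_deriv f [d, (w, 0)] (0, 0)) \<circ> (\<lambda>x. (x, 0)))"
    by (intro linear_compose linear_iter_deriv_hd[OF assms]) (simp add: linear_iff)
  then show ?thesis by (simp add: o_def second_state_derivative_def del: iter_deriv.simps)
qed

lemma bilinear_second_state_derivative:
  assumes "smooth f"
  shows "bilinear (second_state_derivative f)"
proof -
  have "second_state_derivative f x = (\<lambda>w. second_state_derivative f w x)" for x
    using second_state_derivative_commute[OF assms] by blast
  then show ?thesis
    using linear_second_state_derivative[OF assms] unfolding bilinear_def by metis
qed

text \<open>Along the trivial zeros the linearization is \<open>l *\<^sub>R w\<close>, which is
  linear in \<open>l\<close>, so the mixed derivative in the parameter is \<open>w\<close>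
  itself.\<close>

lemma families_second_derivative_zero:
  assumes f: "f \<in> families G \<phi>"
  shows "iter_deriv f [(x, l), (w, 0)] (0, 0) = second_state_derivative f x w + l *\<^sub>R w"
proof -
  note sm = families_smooth[OF f]
  have "((\<lambda>\<tau>. iter_deriv f [(w, 0)] ((0, 0) + \<tau> *\<^sub>R (0, 1))) has_vector_derivative
      iter_deriv f [(0, 1), (w, 0)] ((0, 0) + 0 *\<^sub>R (0, 1))) (at 0)"
    by (rule smooth_has_vector_derivative_line[OF sm])
  then have "((\<lambda>\<tau>. \<tau> *\<^sub>R w) has_vector_derivative iter_deriv f [(0, 1), (w, 0)] (0, 0)) (at 0)"
    using families_derivative_zero[OF f] by (simp del: iter_deriv.simps)
  moreover have "((\<lambda>\<tau>. \<tau> *\<^sub>R w) has_vector_derivative w) (at 0)"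
    by (auto intro!: derivative_eq_intros simp: has_vector_derivative_def)
  ultimately have w: "iter_deriv f [(0, 1), (w, 0)] (0, 0) = w"
    by (rule vector_derivative_unique_at)
  note lin = linear_iter_deriv_hd[OF sm, of "[(w, 0)]" "(0, 0)"]
  have "iter_deriv f [(x, 0) + l *\<^sub>R (0, 1), (w, 0)] (0, 0) =
      iter_deriv f [(x, 0), (w, 0)] (0, 0) + l *\<^sub>R iter_deriv f [(0, 1), (w, 0)] (0, 0)"
    unfolding linear_add[OF lin] linear_cmul[OF lin] ..
  then show ?thesis unfolding w second_state_derivative_def by (simp del: iter_deriv.simps)
qed

text \<open>The linearization, as a function of state and parameter, vanishes at the origin and is
  differentiable there, with the derivative found in \<open>families_second_derivative_zero\<close>.
  Uniformity in \<open>w\<close> comes from finite dimension.\<close>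

lemma families_state_derivative_expansion:
  fixes f :: "'a::euclidean_space \<times> real \<Rightarrow> 'a"
  assumes f: "f \<in> families G \<phi>" and e: "e > 0"
  shows "\<exists>\<delta>>0. \<forall>x l w. norm (x, l) < \<delta> \<longrightarrow>
    norm (iter_deriv f [(w, 0)] (x, l) - second_state_derivative f x w - l *\<^sub>R w) \<le> e * norm (x, l) * norm w"
proof -
  note sm = families_smooth[OF f]
  \<comment> \<open>The Taylor remainder divided by the distance to the origin. At
    \<open>p = 0\<close> the factor \<open>1 / norm p\<close> is 0 by convention, so
    \<open>L p\<close> is linear for every \<open>p\<close>; the estimate at that point is checked
    separately.\<close>
  define L where "L p w = (1 / norm p) *\<^sub>R
    (iter_deriv f [(w, 0)] p - second_state_derivative f (fst p) w - snd p *\<^sub>R w)" for p :: "'a \<times> real" and w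
  have lin1: "linear (\<lambda>w. iter_deriv f [(w, 0)] p)" for p
    using has_derivative_linear[OF smooth_state_has_derivative[OF sm, of "snd p" "fst p"]] by simp
  have lin2: "linear (second_state_derivative f x)" for x
    using bilinear_second_state_derivative[OF sm] by (simp add: bilinear_def)
  have lin: "linear (L p)" for p
    unfolding L_def
    by (intro linear_compose_scale_right linear_compose_sub lin1 lin2) (simp_all add: linear_iff algebra_simps)
  have "((\<lambda>p. L p b) \<longlongrightarrow> 0) (at 0)" for b
  proof -
    have "(iter_deriv f [(b, 0)] has_derivative (\<lambda>d. iter_deriv f [d, (b, 0)] (0, 0))) (at (0, 0))"
      by (rule smooth_has_derivative[OF sm])
    then have "((\<lambda>p. (iter_deriv f [(b, 0)] p - iter_deriv f [(b, 0)] (0, 0) -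
        iter_deriv f [p - (0, 0), (b, 0)] (0, 0)) /\<^sub>R norm (p - (0, 0))) \<longlongrightarrow> 0) (at (0, 0))"
      unfolding has_derivative_at_within by (rule conjunct2)
    moreover have "iter_deriv f [(b, 0)] p - iter_deriv f [(b, 0)] (0, 0) - iter_deriv f [p - (0, 0), (b, 0)] (0, 0) =
        iter_deriv f [(b, 0)] p - second_state_derivative f (fst p) b - snd p *\<^sub>R b" for p
      using families_second_derivative_zero[OF f, of "fst p" "snd p" b] families_derivative_zero[OF f, of b 0]
        diff_zero[of p] unfolding zero_prod_def by (simp del: iter_deriv.simps)
    ultimately have "((\<lambda>p. (iter_deriv f [(b, 0)] p - second_state_derivative f (fst p) b - snd p *\<^sub>R b) /\<^sub>R
        norm (p - (0, 0))) \<longlongrightarrow> 0) (at (0, 0))"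
      by (simp only:)
    then show ?thesis
      unfolding L_def by (simp add: zero_prod_def[symmetric] divide_inverse_commute del: iter_deriv.simps)
  qed
  from eventually_linear_uniform[OF lin this e] obtain \<delta> where \<delta>: "\<delta> > 0"
    "\<And>p w. p \<noteq> 0 \<Longrightarrow> dist p 0 < \<delta> \<Longrightarrow> norm (L p w) \<le> e * norm w"
    unfolding eventually_at by auto
  have "norm (iter_deriv f [(w, 0)] (x, l) - second_state_derivative f x w - l *\<^sub>R w) \<le> e * norm (x, l) * norm w"
    if "norm (x, l) < \<delta>" for x l w
  proof (cases "(x, l) = 0")
    case True
    then have "x = 0" "l = 0" by (simp_all add: zero_prod_def)
    moreover have "second_state_derivative f 0 w = 0"
      by (rule linear_0[OF linear_second_state_derivative[OF sm]])
    ultimately show ?thesis using families_derivative_zero[OF f, of w 0] by (simp del: iter_deriv.simps)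
  next
    case False
    define N where "N = norm (x, l)"
    have N: "N > 0" using False unfolding N_def by (rule zero_less_norm_iff[THEN iffD2])
    have "norm (L (x, l) w) \<le> e * norm w"
      using \<delta>(2)[OF False] that by simp
    then show ?thesis
      unfolding L_def N_def[symmetric] using N by (simp add: divide_le_eq mult_ac del: iter_deriv.simps)
  qed
  then show ?thesis using \<delta>(1) by blast
qed

lemma smooth_state_line_derivative:
  assumes "smooth f"
  shows "((\<lambda>\<tau>. f (\<tau> *\<^sub>R x, l)) has_vector_derivative iter_deriv f [(x, 0)] (\<tau> *\<^sub>R x, l)) (at \<tau>)"
  using smooth_has_vector_derivative_line[OF assms, of "[]" "(0, l)" "(x, 0)"] by simp

lemma norm_scaled_pair_le:
  fixes x :: "'a::real_normed_vector"
  assumes "0 \<le> \<tau>" "\<tau> \<le> 1"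
  shows "norm (\<tau> *\<^sub>R x, l::real) \<le> norm (x, l)"
  unfolding norm_Pair using assms
  by (intro real_sqrt_le_mono add_right_mono power_mono) (auto simp: mult_left_le_one_le)

text \<open>The mean value inequality is applied along the segment from \<open>(0, l)\<close>, where
  \<open>f\<close> vanishes, to \<open>(x, l)\<close>. The length of this segment is the factor
  \<open>norm x\<close> in the remainder, which is cancelled later to exclude tangents along the
  parameter axis.\<close>

lemma families_quadratic_expansion:
  assumes irr: "absolutely_irreducible G \<phi>" and f: "f \<in> families G \<phi>" and e: "e > 0"
  shows "\<exists>\<delta>>0. \<forall>x l. norm (x, l) < \<delta> \<longrightarrow>
    norm (f (x, l) - l *\<^sub>R x - (1/2) *\<^sub>R second_state_derivative f x x) \<le> e * norm (x, l) * norm x"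
proof -
  note sm = families_smooth[OF f]
  obtain \<delta> where \<delta>: "\<delta> > 0" "\<And>x l w. norm (x, l) < \<delta> \<Longrightarrow>
    norm (iter_deriv f [(w, 0)] (x, l) - second_state_derivative f x w - l *\<^sub>R w) \<le> e * norm (x, l) * norm w"
    using families_state_derivative_expansion[OF f e] by blast
  have "norm (f (x, l) - l *\<^sub>R x - (1/2) *\<^sub>R second_state_derivative f x x) \<le> e * norm (x, l) * norm x"
    if small: "norm (x, l) < \<delta>" for x l
  proof -
    let ?S = "second_state_derivative f x x"
    define m where "m \<tau> = f (\<tau> *\<^sub>R x, l) - \<tau> *\<^sub>R (l *\<^sub>R x) - (\<tau>\<^sup>2 / 2) *\<^sub>R ?S" for \<tau>
    define m' where "m' \<tau> = iter_deriv f [(x, 0)] (\<tau> *\<^sub>R x, l) - l *\<^sub>R x - \<tau> *\<^sub>R ?S" for \<tau>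
    have "(m has_vector_derivative m' \<tau>) (at \<tau>)" for \<tau>
      unfolding m_def m'_def
    proof (intro has_vector_derivative_diff smooth_state_line_derivative[OF sm])
      show "((\<lambda>\<tau>. \<tau> *\<^sub>R (l *\<^sub>R x)) has_vector_derivative l *\<^sub>R x) (at \<tau>)"
        by (auto intro!: derivative_eq_intros simp: has_vector_derivative_def)
      have "((\<lambda>\<tau>. \<tau>\<^sup>2 / 2) has_field_derivative \<tau>) (at \<tau>)"
        by (auto intro!: derivative_eq_intros)
      then show "((\<lambda>\<tau>. (\<tau>\<^sup>2 / 2) *\<^sub>R ?S) has_vector_derivative \<tau> *\<^sub>R ?S) (at \<tau>)"
        using has_vector_derivative_scaleR[OF _ has_vector_derivative_const, of _ \<tau> \<tau> UNIV ?S] by simp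
    qed
    moreover have "norm (m' \<tau>) \<le> e * norm (x, l) * norm x" if \<tau>: "0 \<le> \<tau>" "\<tau> \<le> 1" for \<tau>
    proof -
      note le = norm_scaled_pair_le[OF \<tau>, of x l]
      have "second_state_derivative f (\<tau> *\<^sub>R x) x = \<tau> *\<^sub>R ?S"
        by (rule linear_cmul[OF linear_second_state_derivative[OF sm]])
      then have "m' \<tau> = iter_deriv f [(x, 0)] (\<tau> *\<^sub>R x, l) - second_state_derivative f (\<tau> *\<^sub>R x) x - l *\<^sub>R x"
        unfolding m'_def by simp
      then have "norm (m' \<tau>) \<le> e * norm (\<tau> *\<^sub>R x, l) * norm x"
        using \<delta>(2)[of "\<tau> *\<^sub>R x" l x] le small by simp
      also have "\<dots> \<le> e * norm (x, l) * norm x"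
        using le e by (intro mult_right_mono mult_left_mono) auto
      finally show ?thesis .
    qed
    ultimately have "norm (m 1 - m 0) \<le> 1 * (e * norm (x, l) * norm x)"
      by (intro norm_diff_le_vector_derivative) auto
    then show ?thesis using families_zero[OF irr f, of l] by (simp add: m_def)
  qed
  then show ?thesis using \<delta>(1) by blast
qed

text \<open>Away from \<open>l = 0\<close> the derivative \<open>l *\<^sub>R v\<close> at the trivial zero is invertible, so trivial zeros are isolated.\<close>

lemma families_trivial_zero_isolated:
  fixes f :: "'a::euclidean_space \<times> real \<Rightarrow> 'a"
  assumes irr: "absolutely_irreducible G \<phi>" and f: "f \<in> families G \<phi>" and l0: "l0 \<noteq> 0"
  shows "\<exists>\<delta>>0. \<forall>x l. dist (x, l) (0, l0) < \<delta> \<and> f (x, l) = 0 \<longrightarrow> x = 0"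
proof -
  note sm = families_smooth[OF f]
  define L where "L p w = iter_deriv f [(w, 0)] p - l0 *\<^sub>R w" for p w
  have lin1: "linear (\<lambda>w. iter_deriv f [(w, 0)] p)" for p
    using has_derivative_linear[OF smooth_state_has_derivative[OF sm, of "snd p" "fst p"]] by simp
  have lin: "linear (L p)" for p
    unfolding L_def
    by (intro linear_compose_sub lin1) (simp add: linear_iff algebra_simps)
  have "((\<lambda>p. L p b) \<longlongrightarrow> 0) (at (0, l0))" for b
  proof -
    have "isCont (iter_deriv f [(b, 0)]) (0, l0)"
      using smooth_has_derivative[OF sm] by (rule has_derivative_continuous)
    then have "((\<lambda>p. iter_deriv f [(b, 0)] p - l0 *\<^sub>R b) \<longlongrightarrow> l0 *\<^sub>R b - l0 *\<^sub>R b) (at (0, l0))"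
      unfolding isCont_def families_derivative_zero[OF f] by (intro tendsto_intros)
    then show ?thesis unfolding L_def by simp
  qed
  \<comment> \<open>Any bound below \<open>\<bar>l0\<bar>\<close> would do: at a zero
    \<open>(x, l)\<close> the map \<open>m\<close> moves by exactly
    \<open>\<bar>l0\<bar> * norm x\<close> over the unit interval.\<close>
  from eventually_linear_uniform[OF lin this, of "\<bar>l0\<bar> / 2"] l0 obtain \<delta> where \<delta>: "\<delta> > 0"
    "\<And>p w. p \<noteq> (0, l0) \<Longrightarrow> dist p (0, l0) < \<delta> \<Longrightarrow> norm (L p w) \<le> \<bar>l0\<bar> / 2 * norm w"
    unfolding eventually_at by auto
  have "x = 0" if small: "dist (x, l) (0, l0) < \<delta>" and zero: "f (x, l) = 0" for x l
  proof -
    define m where "m \<tau> = f (\<tau> *\<^sub>R x, l) - \<tau> *\<^sub>R (l0 *\<^sub>R x)" for \<tau>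
    have "(m has_vector_derivative L (\<tau> *\<^sub>R x, l) x) (at \<tau>)" for \<tau>
      unfolding m_def L_def
      by (intro has_vector_derivative_diff smooth_state_line_derivative[OF sm])
        (auto intro!: derivative_eq_intros simp: has_vector_derivative_def)
    moreover have "norm (L (\<tau> *\<^sub>R x, l) x) \<le> \<bar>l0\<bar> / 2 * norm x" if \<tau>: "0 \<le> \<tau>" "\<tau> \<le> 1" for \<tau>
    proof (cases "(\<tau> *\<^sub>R x, l) = (0, l0)")
      case True
      show ?thesis using families_derivative_zero[OF f, of x l0] unfolding L_def True by (simp del: iter_deriv.simps)
    next
      case False
      have "dist (\<tau> *\<^sub>R x, l) (0, l0) \<le> dist (x, l) (0, l0)"
        using norm_scaled_pair_le[OF \<tau>, of x "l - l0"] by (simp add: dist_norm)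
      then show ?thesis using \<delta>(2)[OF False] small by simp
    qed
    ultimately have "norm (m 1 - m 0) \<le> 1 * (\<bar>l0\<bar> / 2 * norm x)"
      by (intro norm_diff_le_vector_derivative) auto
    then have "\<bar>l0\<bar> * norm x \<le> \<bar>l0\<bar> / 2 * norm x"
      using families_zero[OF irr f, of l] zero by (simp add: m_def)
    then show "x = 0" using l0 by (simp add: mult_le_cancel_right)
  qed
  then show ?thesis using \<delta>(1) by blast
qed

subsection \<open>Tangents of non-trivial branches\<close>

lemma tendsto_slope_at_right:
  fixes c :: "real \<Rightarrow> 'a::real_normed_vector"
  assumes "(c has_vector_derivative d) (at 0 within {0..\<delta>})" "\<delta> > 0" "c 0 = 0"
  shows "((\<lambda>s. (1 / s) *\<^sub>R c s) \<longlongrightarrow> d) (at_right 0)"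
proof -
  have "((\<lambda>s. (c s - s *\<^sub>R d) /\<^sub>R \<bar>s\<bar>) \<longlongrightarrow> 0) (at_right 0)"
    using assms unfolding has_vector_derivative_def has_derivative_within
    by (simp add: at_within_Icc_at_right diff_diff_eq divide_inverse_commute)
  then have "((\<lambda>s. (c s - s *\<^sub>R d) /\<^sub>R \<bar>s\<bar> + d) \<longlongrightarrow> 0 + d) (at_right 0)"
    by (intro tendsto_intros)
  moreover have "\<forall>\<^sub>F s in at_right 0. (c s - s *\<^sub>R d) /\<^sub>R \<bar>s\<bar> + d = (1 / s) *\<^sub>R c s"
    by (rule eventually_at_right_less[THEN eventually_mono])
      (simp add: algebra_simps divide_inverse)
  ultimately show ?thesis
    by (simp add: tendsto_cong)
qed

lemma solution_branch_continuous:
  assumes "solution_branch_on f \<delta> \<gamma>"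
  shows "continuous_on {0..\<delta>} \<gamma>"
  using assms unfolding solution_branch_on_def C1_embedding_on_def continuous_on_eq_continuous_within
  by (meson has_vector_derivative_continuous)

lemma solution_branch_tangent:
  assumes "solution_branch_on f \<delta> \<gamma>"
  obtains u \<mu> where "(\<gamma> has_vector_derivative (u, \<mu>)) (at 0 within {0..\<delta>})" "(u, \<mu>) \<noteq> 0"
proof -
  have "0 \<in> {0..\<delta>}" using assms by (simp add: solution_branch_on_def)
  then obtain d where "(\<gamma> has_vector_derivative d) (at 0 within {0..\<delta>})" "d \<noteq> 0"
    using assms unfolding solution_branch_on_def C1_embedding_on_def by blast
  then show ?thesis using that by (metis surj_pair)
qed

text \<open>A branch is injective and starts at the origin, so it cannot return there.\<close>

lemma solution_branch_param_nonzero: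
  assumes br: "solution_branch_on f \<delta> \<gamma>" and s: "s \<in> {0<..\<delta>}" and x: "fst (\<gamma> s) = 0"
  shows "snd (\<gamma> s) \<noteq> 0"
proof
  assume "snd (\<gamma> s) = 0"
  then have "\<gamma> s = \<gamma> 0" using x br by (simp add: solution_branch_on_def prod_eq_iff)
  moreover have "inj_on \<gamma> {0..\<delta>}"
    using br by (simp add: solution_branch_on_def C1_embedding_on_def)
  ultimately show False using s by (auto dest: inj_onD[where x = s and y = 0])
qed

text \<open>Non-triviality only says that \<open>x\<close> does not vanish identically, but
  excluding tangents along the parameter axis requires division by \<open>norm x\<close>. The zero
  set of \<open>x\<close> is closed in the connected interval by continuity, and open because
  trivial zeros with nonzero parameter are isolated.\<close>

lemma nontrivial_branch_nonzero:
  assumes irr: "absolutely_irreducible G \<phi>" and f: "f \<in> families G \<phi>"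
    and br: "solution_branch_on f \<delta> \<gamma>" and nontriv: "\<not> (\<forall>s\<in>{0<..\<delta>}. fst (\<gamma> s) = 0)"
    and s: "s \<in> {0<..\<delta>}"
  shows "fst (\<gamma> s) \<noteq> 0"
proof
  assume s0: "fst (\<gamma> s) = 0"
  have cont: "continuous_on {0<..\<delta>} \<gamma>"
    using solution_branch_continuous[OF br] by (rule continuous_on_subset) auto
  define Z where "Z = {s \<in> {0<..\<delta>}. fst (\<gamma> s) = 0}"
  have "closedin (top_of_set {0<..\<delta>}) Z"
    unfolding Z_def using continuous_closedin_preimage_constant[OF continuous_on_fst[OF cont]] by simp
  moreover have "openin (top_of_set {0<..\<delta>}) Z"
    unfolding openin_euclidean_subtopology_iff
  proof (intro conjI ballI)
    fix a assume a: "a \<in> Z"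
    then have a': "a \<in> {0<..\<delta>}" "\<gamma> a = (0, snd (\<gamma> a))" unfolding Z_def by (auto simp: prod_eq_iff)
    have "snd (\<gamma> a) \<noteq> 0"
      using solution_branch_param_nonzero[OF br, of a] a unfolding Z_def by blast
    from families_trivial_zero_isolated[OF irr f this] obtain d where d: "d > 0"
      "\<And>x l. dist (x, l) (0, snd (\<gamma> a)) < d \<Longrightarrow> f (x, l) = 0 \<Longrightarrow> x = 0" by blast
    obtain e where e: "e > 0" "\<And>b. b \<in> {0<..\<delta>} \<Longrightarrow> dist b a < e \<Longrightarrow> dist (\<gamma> b) (\<gamma> a) < d"
      using cont a'(1) d(1) unfolding continuous_on_iff by blast
    show "\<exists>e>0. \<forall>b\<in>{0<..\<delta>}. dist b a < e \<longrightarrow> b \<in> Z"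
    proof (intro exI[of _ e] conjI ballI impI e(1))
      fix b assume b: "b \<in> {0<..\<delta>}" "dist b a < e"
      have "f (\<gamma> b) = 0" using br b(1) unfolding solution_branch_on_def by auto
      then have "fst (\<gamma> b) = 0"
        using d(2)[of "fst (\<gamma> b)" "snd (\<gamma> b)"] e(2)[OF b] a'(2) by simp
      then show "b \<in> Z" using b(1) unfolding Z_def by simp
    qed
  qed (auto simp: Z_def)
  moreover have "connected {0<..\<delta>}" by (rule connected_Ioc)
  ultimately have "Z = {} \<or> Z = {0<..\<delta>}" unfolding connected_clopen by blast
  moreover have "s \<in> Z" using s s0 unfolding Z_def by simp
  ultimately show False using nontriv unfolding Z_def by blast
qed

text \<open>The leading part of the equation is homogeneous of degree two, so rescaling by
  \<open>1 / s\<close> turns it into the same equation for \<open>X s\<close> and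
  \<open>M s\<close>, up to a remainder that is a small multiple of \<open>norm (X s)\<close>. The
  tangent is the limit of these rescaled points.\<close>

lemma nontrivial_branch_tangent_equation:
  assumes irr: "absolutely_irreducible G \<phi>" and f: "f \<in> families G \<phi>"
    and br: "solution_branch_on f \<delta> \<gamma>" and nontriv: "\<not> (\<forall>s\<in>{0<..\<delta>}. fst (\<gamma> s) = 0)"
    and deriv: "(\<gamma> has_vector_derivative (u, \<mu>)) (at 0 within {0..\<delta>})" and nz: "(u, \<mu>) \<noteq> 0"
  shows "\<mu> *\<^sub>R u + (1/2) *\<^sub>R second_state_derivative f u u = 0" and "u \<noteq> 0"
proof -
  let ?S = "second_state_derivative f"
  note sm = families_smooth[OF f]
  have \<delta>: "\<delta> > 0" and \<gamma>0: "\<gamma> 0 = (0, 0)" using br by (simp_all add: solution_branch_on_def)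
  have lim: "((\<lambda>s. (1 / s) *\<^sub>R \<gamma> s) \<longlongrightarrow> (u, \<mu>)) (at_right 0)"
    using tendsto_slope_at_right[OF deriv \<delta>] \<gamma>0 by (simp add: zero_prod_def)
  define X where "X s = (1 / s) *\<^sub>R fst (\<gamma> s)" for s
  define M where "M s = (1 / s) *\<^sub>R snd (\<gamma> s)" for s
  have X: "(X \<longlongrightarrow> u) (at_right 0)" and M: "(M \<longlongrightarrow> \<mu>) (at_right 0)"
    using tendsto_fst[OF lim] tendsto_snd[OF lim] by (simp_all add: X_def[abs_def] M_def[abs_def])
  have S: "((\<lambda>s. ?S (X s) (X s)) \<longlongrightarrow> ?S u u) (at_right 0)"
    by (rule bounded_bilinear.tendsto[OF bilinear_second_state_derivative[OF sm,
          unfolded bilinear_conv_bounded_bilinear] X X])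
  have scale: "?S x x = (s * s) *\<^sub>R ?S ((1 / s) *\<^sub>R x) ((1 / s) *\<^sub>R x)" if "s > 0" for s x
    using that bilinear_second_state_derivative[OF sm]
    by (simp add: bilinear_lmul bilinear_rmul)
  have tends0: "(\<gamma> \<longlongrightarrow> 0) (at_right 0)"
  proof -
    have "(\<gamma> \<longlongrightarrow> \<gamma> 0) (at 0 within {0..\<delta>})"
      using solution_branch_continuous[OF br] \<delta> unfolding continuous_on_def by simp
    then show ?thesis using \<gamma>0 \<delta> by (simp add: at_within_Icc_at_right zero_prod_def)
  qed
  have bound: "\<forall>\<^sub>F s in at_right 0. s > 0 \<and> X s \<noteq> 0 \<and>
      norm (M s *\<^sub>R X s + (1/2) *\<^sub>R ?S (X s) (X s)) \<le> e * norm ((1 / s) *\<^sub>R \<gamma> s) * norm (X s)"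
    if e: "e > 0" for e
  proof -
    obtain d where d: "d > 0" "\<And>x l. norm (x, l) < d \<Longrightarrow>
      norm (f (x, l) - l *\<^sub>R x - (1/2) *\<^sub>R ?S x x) \<le> e * norm (x, l) * norm x"
      using families_quadratic_expansion[OF irr f e] by blast
    have "\<forall>\<^sub>F s in at_right 0. norm (\<gamma> s) < d"
      using tendstoD[OF tends0 d(1)] by simp
    moreover have "\<forall>\<^sub>F s in at_right 0. s \<in> {0<..\<delta>}"
      using \<delta> unfolding eventually_at_right_field by auto
    ultimately show ?thesis
    proof eventually_elim
      case (elim s)
      let ?x = "fst (\<gamma> s)" and ?l = "snd (\<gamma> s)"
      have s: "s > 0" using elim by simp
      have "f (\<gamma> s) = 0" using br elim(2) unfolding solution_branch_on_def by auto
      then have "f (\<gamma> s) - ?l *\<^sub>R ?x - (1/2) *\<^sub>R ?S ?x ?x = - (?l *\<^sub>R ?x + (1/2) *\<^sub>R ?S ?x ?x)"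
        by simp
      then have "norm (?l *\<^sub>R ?x + (1/2) *\<^sub>R ?S ?x ?x) \<le> e * norm (\<gamma> s) * norm ?x"
        using d(2)[of ?x ?l] elim(1) by (metis norm_minus_cancel prod.collapse)
      moreover have "?l *\<^sub>R ?x + (1/2) *\<^sub>R ?S ?x ?x = (s * s) *\<^sub>R (M s *\<^sub>R X s + (1/2) *\<^sub>R ?S (X s) (X s))"
        unfolding scale[OF s, of ?x] using s by (simp add: X_def M_def scaleR_add_right)
      moreover have "e * norm (\<gamma> s) * norm ?x = (s * s) * (e * norm ((1 / s) *\<^sub>R \<gamma> s) * norm (X s))"
        using s by (simp add: X_def)
      ultimately have "(s * s) * norm (M s *\<^sub>R X s + (1/2) *\<^sub>R ?S (X s) (X s)) \<le>
          (s * s) * (e * norm ((1 / s) *\<^sub>R \<gamma> s) * norm (X s))"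
        using s by simp
      then have "norm (M s *\<^sub>R X s + (1/2) *\<^sub>R ?S (X s) (X s)) \<le> e * norm ((1 / s) *\<^sub>R \<gamma> s) * norm (X s)"
        by (rule mult_left_le_imp_le) (use s in simp)
      moreover have "X s \<noteq> 0"
        using nontrivial_branch_nonzero[OF irr f br nontriv elim(2)] s by (simp add: X_def)
      ultimately show ?case using s by simp
    qed
  qed
  have le: "norm (\<mu> *\<^sub>R u + (1/2) *\<^sub>R ?S u u) \<le> e * norm (u, \<mu>) * norm u" if e: "e > 0" for e
  proof (rule tendsto_le)
    show "((\<lambda>s. norm (M s *\<^sub>R X s + (1/2) *\<^sub>R ?S (X s) (X s))) \<longlongrightarrow> norm (\<mu> *\<^sub>R u + (1/2) *\<^sub>R ?S u u)) (at_right 0)"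
      by (intro tendsto_intros M X S)
    show "((\<lambda>s. e * norm ((1 / s) *\<^sub>R \<gamma> s) * norm (X s)) \<longlongrightarrow> e * norm (u, \<mu>) * norm u) (at_right 0)"
      by (intro tendsto_intros lim X)
    show "\<forall>\<^sub>F s in at_right 0. norm (M s *\<^sub>R X s + (1/2) *\<^sub>R ?S (X s) (X s)) \<le> e * norm ((1 / s) *\<^sub>R \<gamma> s) * norm (X s)"
      using bound[OF e] by eventually_elim blast
  qed simp
  show "\<mu> *\<^sub>R u + (1/2) *\<^sub>R ?S u u = 0"
  proof -
    \<comment> \<open>The estimate holds for every \<open>e\<close>; \<open>C\<close> absorbs its
      fixed factor, and the summand 1 keeps it positive.\<close>
    define C where "C = norm (u, \<mu>) * norm u + 1"
    have C: "C > 0" unfolding C_def by (simp add: add_nonneg_pos)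
    have "norm (\<mu> *\<^sub>R u + (1/2) *\<^sub>R ?S u u) \<le> 0 + e" if "e > 0" for e
    proof -
      have "norm (\<mu> *\<^sub>R u + (1/2) *\<^sub>R ?S u u) \<le> e / C * norm (u, \<mu>) * norm u"
        using le[of "e / C"] that C by simp
      also have "\<dots> \<le> e / C * C"
        unfolding C_def using that C by (simp add: C_def distrib_left mult.assoc)
      finally show ?thesis using C by simp
    qed
    then have "norm (\<mu> *\<^sub>R u + (1/2) *\<^sub>R ?S u u) \<le> 0" by (rule field_le_epsilon)
    then show ?thesis by simp
  qed
  show "u \<noteq> 0"
  proof
    have half: "0 < (1/2 :: real)" by simp
    assume u: "u = 0"
    obtain K where K: "\<And>x y. norm (?S x y) \<le> norm x * norm y * K"
      using bilinear_second_state_derivative[OF sm] bounded_bilinear.bounded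
      unfolding bilinear_conv_bounded_bilinear by blast
    \<comment> \<open>The bound for \<open>e = 1/2\<close>, divided by \<open>norm (X s)\<close>.
      With \<open>u = 0\<close> the right side is half of \<open>\<bar>\<mu>\<bar>\<close>, which
      forces a zero tangent; any constant below 1 would serve.\<close>
    have "\<bar>\<mu>\<bar> \<le> 1/2 * K * norm u + 1/2 * norm (u, \<mu>)"
    proof (rule tendsto_le)
      show "((\<lambda>s. \<bar>M s\<bar>) \<longlongrightarrow> \<bar>\<mu>\<bar>) (at_right 0)" by (intro tendsto_intros M)
      show "((\<lambda>s. 1/2 * K * norm (X s) + 1/2 * norm ((1 / s) *\<^sub>R \<gamma> s)) \<longlongrightarrow> 1/2 * K * norm u + 1/2 * norm (u, \<mu>)) (at_right 0)"
        by (intro tendsto_intros X lim)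
      show "\<forall>\<^sub>F s in at_right 0. \<bar>M s\<bar> \<le> 1/2 * K * norm (X s) + 1/2 * norm ((1 / s) *\<^sub>R \<gamma> s)"
        using bound[OF half]
      proof eventually_elim
        case (elim s)
        have "\<bar>M s\<bar> * norm (X s) = norm ((M s *\<^sub>R X s + (1/2) *\<^sub>R ?S (X s) (X s)) - (1/2) *\<^sub>R ?S (X s) (X s))"
          by simp
        also have "\<dots> \<le> norm (M s *\<^sub>R X s + (1/2) *\<^sub>R ?S (X s) (X s)) + norm ((1/2) *\<^sub>R ?S (X s) (X s))"
          by (rule norm_triangle_ineq4)
        also have "\<dots> \<le> 1/2 * norm ((1 / s) *\<^sub>R \<gamma> s) * norm (X s) + 1/2 * (norm (X s) * norm (X s) * K)"
          using elim K[of "X s" "X s"] by (intro add_mono) (blast, simp)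
        also have "\<dots> = (1/2 * K * norm (X s) + 1/2 * norm ((1 / s) *\<^sub>R \<gamma> s)) * norm (X s)"
          by (simp add: algebra_simps)
        finally show ?case using elim by (simp only: mult_le_cancel_right) auto
      qed
    qed simp
    then show False using u nz by (simp add: norm_Pair zero_prod_def)
  qed
qed

subsection \<open>The index of a branch\<close>

definition quadratic_part :: "('a::euclidean_space \<times> real \<Rightarrow> 'a) \<Rightarrow> 'a \<Rightarrow> 'a" where
  "quadratic_part f v = (1/2) *\<^sub>R second_state_derivative f v v"

text \<open>Expresses the quadratic part through values of \<open>f\<close> alone, so that
  equivariance of \<open>f\<close> passes to the limit.\<close>

lemma quadratic_part_limit:
  assumes irr: "absolutely_irreducible G \<phi>" and f: "f \<in> families G \<phi>"
  shows "((\<lambda>t. (1 / (t * t)) *\<^sub>R f (t *\<^sub>R x, 0)) \<longlongrightarrow> quadratic_part f x) (at_right 0)"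
proof (rule tendstoI)
  note sm = families_smooth[OF f]
  fix e :: real assume e: "e > 0"
  define C where "C = norm x * norm x + 1"
  have C: "C > 0" unfolding C_def by (simp add: add_nonneg_pos)
  obtain d where d: "d > 0" "\<And>x l. norm (x, l) < d \<Longrightarrow>
      norm (f (x, l) - l *\<^sub>R x - (1/2) *\<^sub>R second_state_derivative f x x) \<le> e / C * norm (x, l) * norm x"
    using families_quadratic_expansion[OF irr f, of "e / C"] e C by (meson divide_pos_pos)
  have "((\<lambda>t. norm (t *\<^sub>R x)) \<longlongrightarrow> norm (0 *\<^sub>R x)) (at_right 0)"
    by (intro tendsto_intros)
  then have "\<forall>\<^sub>F t in at_right 0. norm (t *\<^sub>R x) < d"
    using d(1) by (intro order_tendstoD(2)) auto
  moreover have "\<forall>\<^sub>F t::real in at_right 0. t > 0" by (rule eventually_at_right_less)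
  ultimately show "\<forall>\<^sub>F t in at_right 0. dist ((1 / (t * t)) *\<^sub>R f (t *\<^sub>R x, 0)) (quadratic_part f x) < e"
  proof eventually_elim
    case (elim t)
    have "(1/2) *\<^sub>R second_state_derivative f (t *\<^sub>R x) (t *\<^sub>R x) = (t * t) *\<^sub>R quadratic_part f x"
      unfolding quadratic_part_def using bilinear_second_state_derivative[OF sm]
      by (simp add: bilinear_lmul bilinear_rmul)
    moreover have "f (t *\<^sub>R x, 0) = (t * t) *\<^sub>R ((1 / (t * t)) *\<^sub>R f (t *\<^sub>R x, 0))"
      using elim by simp
    ultimately have "f (t *\<^sub>R x, 0) - (1/2) *\<^sub>R second_state_derivative f (t *\<^sub>R x) (t *\<^sub>R x) =
        (t * t) *\<^sub>R ((1 / (t * t)) *\<^sub>R f (t *\<^sub>R x, 0) - quadratic_part f x)"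
      by (metis scaleR_diff_right)
    then have "(t * t) * norm ((1 / (t * t)) *\<^sub>R f (t *\<^sub>R x, 0) - quadratic_part f x) \<le>
        e / C * norm (t *\<^sub>R x) * norm (t *\<^sub>R x)"
      using d(2)[of "t *\<^sub>R x" 0] elim by simp
    also have "\<dots> = (t * t) * (e / C * (norm x * norm x))" using elim by simp
    finally have "norm ((1 / (t * t)) *\<^sub>R f (t *\<^sub>R x, 0) - quadratic_part f x) \<le> e / C * (norm x * norm x)"
      by (rule mult_left_le_imp_le) (use elim in simp)
    also have "\<dots> < e / C * C"
      using e C by (intro mult_strict_left_mono) (simp_all add: C_def)
    finally show ?case using C by (simp add: dist_norm)
  qed
qed

lemma quadratic_part_equivariant:
  assumes irr: "absolutely_irreducible G \<phi>" and f: "f \<in> families G \<phi>" and g: "g \<in> carrier G"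
  shows "quadratic_part f (\<phi> g x) = \<phi> g (quadratic_part f x)"
proof (rule tendsto_unique)
  note lin = linear_action[OF irr g]
  show "((\<lambda>t. (1 / (t * t)) *\<^sub>R f (t *\<^sub>R \<phi> g x, 0)) \<longlongrightarrow> quadratic_part f (\<phi> g x)) (at_right 0)"
    by (rule quadratic_part_limit[OF irr f])
  have "(1 / (t * t)) *\<^sub>R f (t *\<^sub>R \<phi> g x, 0) = \<phi> g ((1 / (t * t)) *\<^sub>R f (t *\<^sub>R x, 0))" for t
    using families_equivariant[OF f g, of "t *\<^sub>R x" 0] by (simp add: linear_cmul[OF lin])
  then show "((\<lambda>t. (1 / (t * t)) *\<^sub>R f (t *\<^sub>R \<phi> g x, 0)) \<longlongrightarrow> \<phi> g (quadratic_part f x)) (at_right 0)"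
    using bounded_linear.tendsto[OF lin[unfolded linear_conv_bounded_linear] quadratic_part_limit[OF irr f, of x]]
    by simp
qed simp

lemma quadratic_part_in_quadratic_equivariants:
  assumes irr: "absolutely_irreducible G \<phi>" and f: "f \<in> families G \<phi>"
  shows "quadratic_part f \<in> quadratic_equivariants G \<phi>"
proof -
  have "bilinear (\<lambda>x y. (1/2) *\<^sub>R second_state_derivative f x y)"
    using bilinear_second_state_derivative[OF families_smooth[OF f]]
    unfolding bilinear_def by (auto intro: linear_compose_scale_right)
  then show ?thesis
    unfolding quadratic_equivariants_def equivariant_def
    using quadratic_part_equivariant[OF irr f] by (auto simp: quadratic_part_def)
qed

text \<open>Carries equivariance from the quadratic part over to the bilinear form, as the trace
  argument requires.\<close>

lemma second_state_derivative_polarization: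
  assumes "smooth f"
  shows "second_state_derivative f x y = quadratic_part f (x + y) - quadratic_part f x - quadratic_part f y"
  unfolding quadratic_part_def
  using bilinear_second_state_derivative[OF assms] second_state_derivative_commute[OF assms, of y x]
  by (simp add: bilinear_ladd bilinear_radd scaleR_add_right scaleR_2[symmetric])

lemma trace_second_state_derivative:
  assumes irr: "absolutely_irreducible G \<phi>" and f: "f \<in> families G \<phi>"
  shows "(\<Sum>b\<in>Basis. inner (second_state_derivative f v b) b) = 0"
proof (rule trace_bilinear_equivariant[OF irr])
  note sm = families_smooth[OF f]
  show "bilinear (second_state_derivative f)" by (rule bilinear_second_state_derivative[OF sm])
  fix g x y assume g: "g \<in> carrier G"
  note lin = linear_action[OF irr g]
  show "second_state_derivative f (\<phi> g x) (\<phi> g y) = \<phi> g (second_state_derivative f x y)"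
    unfolding second_state_derivative_polarization[OF sm]
    by (simp add: linear_diff[OF lin] linear_add[OF lin, symmetric] quadratic_part_equivariant[OF irr f g])
qed

text \<open>By symmetry the two terms of the product rule agree and cancel the factor 1/2. This
  identifies the derivative in \<open>Q_zero\<close> with the map whose trace vanishes.\<close>

lemma frechet_derivative_quadratic_part:
  assumes "smooth f"
  shows "frechet_derivative (quadratic_part f) (at v) = second_state_derivative f v"
proof -
  have bb: "bounded_bilinear (second_state_derivative f)"
    using bilinear_second_state_derivative[OF assms] by (simp add: bilinear_conv_bounded_bilinear)
  have "((\<lambda>v. (1/2) *\<^sub>R second_state_derivative f v v) has_derivative
      (\<lambda>h. (1/2) *\<^sub>R (second_state_derivative f v h + second_state_derivative f h v))) (at v)"
    by (intro has_derivative_scaleR_right bounded_bilinear.FDERIV[OF bb] has_derivative_ident)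
  then have "(quadratic_part f has_derivative second_state_derivative f v) (at v)"
    unfolding second_state_derivative_commute[OF assms, of _ v]
    by (simp add: quadratic_part_def[abs_def] scaleR_2[symmetric])
  then show ?thesis by (rule frechet_derivative_at[symmetric])
qed

text \<open>The condition \<open>Re z * \<mu> \<le> 0\<close> is what the trace argument consumes,
  the trace being a positive multiple of \<open>\<mu>\<close>. It is vacuous for
  \<open>\<mu> = 0\<close>, so both cases can be treated alike afterwards.\<close>

lemma nontrivial_branch_limit_eigenvalue:
  assumes irr: "absolutely_irreducible G \<phi>" and f: "f \<in> families G \<phi>"
    and Q: "quadratic_part f \<in> Q_zero G \<phi>"
    and eq: "\<mu> *\<^sub>R u + quadratic_part f u = 0" and u: "u \<noteq> 0"
  shows "\<exists>z. is_eigenvalue (\<lambda>w. second_state_derivative f u w + \<mu> *\<^sub>R w) z \<and> Re z \<noteq> 0 \<and> Re z * \<mu> \<le> 0"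
proof (cases "\<mu> = 0")
  note sm = families_smooth[OF f]
  note bil = bilinear_second_state_derivative[OF sm]
  have Quu: "second_state_derivative f u u = - (2 * \<mu>) *\<^sub>R u"
  proof -
    have "second_state_derivative f u u = 2 *\<^sub>R quadratic_part f u" by (simp add: quadratic_part_def)
    also have "quadratic_part f u = - (\<mu> *\<^sub>R u)" using eq by (simp add: eq_neg_iff_add_eq_0 add.commute)
    finally show ?thesis by simp
  qed
  {
    case True
    \<comment> \<open>\<open>Q_zero\<close> speaks of zeros on the unit sphere only, so
      \<open>u\<close> is normalized; the derivative scales by \<open>norm u > 0\<close>.\<close>
    define v where "v = (1 / norm u) *\<^sub>R u"
    have uv: "u = norm u *\<^sub>R v" using u by (simp add: v_def)
    have "second_state_derivative f u u = 0" using Quu True by simp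
    then have "v \<in> unit_zeros (quadratic_part f)"
      using u bil by (simp add: unit_zeros_def v_def quadratic_part_def bilinear_lmul bilinear_rmul)
    then obtain z where z: "is_eigenvalue (second_state_derivative f v) z" "Re z \<noteq> 0"
      using Q frechet_derivative_quadratic_part[OF sm, of v] unfolding Q_zero_def by auto
    have "(\<lambda>w. second_state_derivative f u w + \<mu> *\<^sub>R w) = (\<lambda>w. norm u *\<^sub>R second_state_derivative f v w)"
      using True bilinear_lmul[OF bil, of "norm u" v] uv by auto
    then have "is_eigenvalue (\<lambda>w. second_state_derivative f u w + \<mu> *\<^sub>R w) (of_real (norm u) * z)"
      using is_eigenvalue_scaleR[OF z(1), of "norm u"] by simp
    then show ?thesis using z(2) u True by (intro exI[of _ "of_real (norm u) * z"]) simp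
  next
    case False
    have "linear (second_state_derivative f u)" using bil by (simp add: bilinear_def)
    then have "linear (\<lambda>w. second_state_derivative f u w + \<mu> *\<^sub>R w)"
      by (intro linear_compose_add) (simp_all add: linear_iff algebra_simps)
    moreover have "second_state_derivative f u u + \<mu> *\<^sub>R u = (- \<mu>) *\<^sub>R u"
      unfolding Quu by (simp add: scaleR_left_distrib[symmetric] del: scaleR_minus_left)
    ultimately have "is_eigenvalue (\<lambda>w. second_state_derivative f u w + \<mu> *\<^sub>R w) (of_real (- \<mu>))"
      using is_eigenvalue_of_real u by blast
    then show ?thesis using False by (intro exI[of _ "of_real (- \<mu>)"]) (auto simp: mult_nonneg_nonneg not_less)
  }
qed

lemma nontrivial_branch_index:
  fixes f :: "'a::euclidean_space \<times> real \<Rightarrow> 'a"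
  assumes irr: "absolutely_irreducible G \<phi>" and f: "f \<in> families G \<phi>"
    and Q: "quadratic_part f \<in> Q_zero G \<phi>"
    and br: "solution_branch_on f \<delta> \<gamma>" and nontriv: "\<not> (\<forall>s\<in>{0<..\<delta>}. fst (\<gamma> s) = 0)"
  shows "\<forall>\<^sub>F s in at_right 0. 1 \<le> zero_index f (\<gamma> s) \<and> zero_index f (\<gamma> s) < DIM('a)"
proof -
  note sm = families_smooth[OF f]
  have \<delta>: "\<delta> > 0" and \<gamma>0: "\<gamma> 0 = (0, 0)" using br by (simp_all add: solution_branch_on_def)
  obtain u \<mu> where deriv: "(\<gamma> has_vector_derivative (u, \<mu>)) (at 0 within {0..\<delta>})" and nz: "(u, \<mu>) \<noteq> 0"
    by (rule solution_branch_tangent[OF br])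
  note tangent = nontrivial_branch_tangent_equation[OF irr f br nontriv deriv nz]
  define A where "A w = second_state_derivative f u w + \<mu> *\<^sub>R w" for w
  \<comment> \<open>The linearization vanishes at the origin; its slope along the branch converges
    to \<open>A\<close>, and a positive factor does not alter the signs of real parts.\<close>
  define L where "L s w = (1 / s) *\<^sub>R state_derivative f (\<gamma> s) w" for s w
  have lim: "((\<lambda>s. L s w) \<longlongrightarrow> A w) (at_right 0)" for w
  proof -
    have "(\<gamma> has_derivative (\<lambda>h. h *\<^sub>R (u, \<mu>))) (at 0 within {0..\<delta>})"
      using deriv by (simp add: has_vector_derivative_def)
    moreover have "(iter_deriv f [(w, 0)] has_derivative (\<lambda>d. iter_deriv f [d, (w, 0)] (\<gamma> 0))) (at (\<gamma> 0))"
      by (rule smooth_has_derivative[OF sm])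
    ultimately have "((\<lambda>s. iter_deriv f [(w, 0)] (\<gamma> s)) has_derivative
        (\<lambda>h. iter_deriv f [h *\<^sub>R (u, \<mu>), (w, 0)] (\<gamma> 0))) (at 0 within {0..\<delta>})"
      by (rule has_derivative_compose)
    moreover have "iter_deriv f [h *\<^sub>R (u, \<mu>), (w, 0)] (\<gamma> 0) = h *\<^sub>R A w" for h
      unfolding \<gamma>0 linear_cmul[OF linear_iter_deriv_hd[OF sm]] A_def
        families_second_derivative_zero[OF f] ..
    ultimately have "((\<lambda>s. iter_deriv f [(w, 0)] (\<gamma> s)) has_vector_derivative A w) (at 0 within {0..\<delta>})"
      unfolding has_vector_derivative_def by (simp only:)
    moreover have "iter_deriv f [(w, 0)] (\<gamma> 0) = 0"
      using families_derivative_zero[OF f, of w 0] \<gamma>0 by (simp del: iter_deriv.simps)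
    ultimately show ?thesis
      unfolding L_def state_derivative_eq[OF sm] by (rule tendsto_slope_at_right[OF _ \<delta>])
  qed
  have trace: "(\<Sum>b\<in>Basis. inner (A b) b) = \<mu> * DIM('a)"
    unfolding A_def by (simp add: inner_add_left sum.distrib trace_second_state_derivative[OF irr f])
  obtain z where z: "is_eigenvalue A z" "Re z \<noteq> 0" "Re z * \<mu> \<le> 0"
    using nontrivial_branch_limit_eigenvalue[OF irr f Q, of \<mu> u] tangent
    unfolding A_def quadratic_part_def by blast
  have "Re z * (\<Sum>b\<in>Basis. inner (A b) b) \<le> 0"
    unfolding trace using z(3) by (simp add: mult.assoc[symmetric] mult_nonpos_nonneg)
  then obtain z' where z': "is_eigenvalue A z'" "Re z' * Re z < 0"
    using eigenvalue_opposite_sign[OF z(1) _ z(2)] by blast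
  obtain zn zp where zn: "is_eigenvalue A zn" "Re zn < 0" and zp: "is_eigenvalue A zp" "Re zp > 0"
    using z z' by (auto simp: mult_less_0_iff)
  have scale: "state_derivative f (\<gamma> s) = (\<lambda>w. s *\<^sub>R L s w)" if "s > 0" for s
    using that by (simp add: L_def)
  have near: "\<bar>Re a - Re b\<bar> < e" if "dist a b < e" for a b e
    using that abs_Re_le_cmod[of "a - b"] by (simp add: dist_norm)
  have pos: "\<forall>\<^sub>F s::real in at_right 0. s > 0" by (rule eventually_at_right_less)
  have "\<forall>\<^sub>F s in at_right 0. 1 \<le> zero_index f (\<gamma> s)"
  proof -
    \<comment> \<open>The radius is the distance from \<open>zn\<close> to the imaginary axis, so
      real parts stay negative.\<close>
    have "\<forall>\<^sub>F s in at_right 0. \<exists>z'. is_eigenvalue (L s) z' \<and> dist z' zn < - Re zn"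
      using eventually_eigenvalue_near[OF lim zn(1), of "- Re zn"] zn(2) by simp
    then show ?thesis using pos
    proof eventually_elim
      case (elim s)
      then have s: "s > 0" by simp
      obtain w where w: "is_eigenvalue (L s) w" "dist w zn < - Re zn" using elim by blast
      have "Re (of_real s * w) < 0" using near[OF w(2)] s by (simp add: mult_pos_neg)
      then show ?case
        using index_linear_ge_1[OF is_eigenvalue_scaleR[OF w(1), of s]]
        unfolding zero_index_def scale[OF s] by simp
    qed
  qed
  moreover have "\<forall>\<^sub>F s in at_right 0. zero_index f (\<gamma> s) < DIM('a)"
  proof -
    have "\<forall>\<^sub>F s in at_right 0. \<exists>z'. is_eigenvalue (L s) z' \<and> dist z' zp < Re zp"
      using eventually_eigenvalue_near[OF lim zp(1), of "Re zp"] zp(2) by simp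
    then show ?thesis using pos
    proof eventually_elim
      case (elim s)
      then have s: "s > 0" by simp
      obtain w where w: "is_eigenvalue (L s) w" "dist w zp < Re zp" using elim by blast
      have "Re (of_real s * w) > 0" using near[OF w(2)] s by simp
      then show ?case
        using index_linear_less_DIM[OF is_eigenvalue_scaleR[OF w(1), of s]]
        unfolding zero_index_def scale[OF s] by simp
    qed
  qed
  ultimately show ?thesis by (rule eventually_conj)
qed

text \<open>The linearization varies continuously along the branch and has no eigenvalues on the
  imaginary axis, so the index is locally constant on a connected interval.\<close>

lemma hyperbolic_branch_index_constant:
  assumes sm: "smooth f" and br: "solution_branch_on f \<delta> \<gamma>" and hyp: "hyperbolic_branch f \<gamma>"
  obtains k where "\<forall>\<^sub>F s in at_right 0. zero_index f (\<gamma> s) = k"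
proof -
  obtain d where d: "d > 0" "\<And>s. s \<in> {0<..d} \<Longrightarrow> hyperbolic_zero f (\<gamma> s)"
    using hyp unfolding hyperbolic_branch_def by blast
  define I where "I = {0<..min d \<delta>}"
  have cont: "continuous_on I \<gamma>"
    using solution_branch_continuous[OF br] by (rule continuous_on_subset) (auto simp: I_def)
  have local: "\<forall>\<^sub>F b in at a within I. zero_index f (\<gamma> a) = zero_index f (\<gamma> b)" if a: "a \<in> I" for a
  proof -
    have lim: "((\<lambda>b. state_derivative f (\<gamma> b) w) \<longlongrightarrow> state_derivative f (\<gamma> a) w) (at a within I)" for w
    proof -
      have "isCont (iter_deriv f [(w, 0)]) (\<gamma> a)"
        using smooth_has_derivative[OF sm] by (rule has_derivative_continuous)
      then show ?thesis
        unfolding state_derivative_eq[OF sm]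
        by (rule isCont_tendsto_compose) (use cont a in \<open>simp add: continuous_on_def\<close>)
    qed
    have ev: "Re z \<noteq> 0" if "is_eigenvalue (state_derivative f (\<gamma> a)) z" for z
      using d(2)[of a] a that by (simp add: I_def hyperbolic_zero_def)
    have "\<forall>\<^sub>F b in at a within I. index_linear (state_derivative f (\<gamma> b)) = index_linear (state_derivative f (\<gamma> a))"
      by (rule eventually_index_linear_eq[OF lim ev])
    then show ?thesis
      unfolding zero_index_def by eventually_elim simp
  qed
  define r where "r = min d \<delta>"
  have r: "r > 0" using d(1) br by (simp add: r_def solution_branch_on_def)
  have "zero_index f (\<gamma> s) = zero_index f (\<gamma> r)" if "s \<in> {0<..r}" for s
    by (rule connected_local_const[of I]) (use that r local in \<open>auto simp: I_def r_def connected_Ioc\<close>)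
  then have "\<forall>\<^sub>F s in at_right 0. zero_index f (\<gamma> s) = zero_index f (\<gamma> r)"
    using r unfolding eventually_at_right_field by (meson greaterThanAtMost_iff less_imp_le)
  then show ?thesis by (rule that)
qed

section \<open>Germs at the origin and classes of branches\<close>

lemma eventually_at_right_0_iff:
  "(\<forall>\<^sub>F s in at_right (0::real). P s) \<longleftrightarrow> (\<exists>\<delta>>0. \<forall>s\<in>{0<..\<delta>}. P s)"
proof
  assume "\<forall>\<^sub>F s in at_right 0. P s"
  then obtain b where "b > 0" "\<And>s. 0 < s \<Longrightarrow> s < b \<Longrightarrow> P s"
    unfolding eventually_at_right_field by blast
  \<comment> \<open>Halving \<open>b\<close> makes room for the closed right end point.\<close>
  then show "\<exists>\<delta>>0. \<forall>s\<in>{0<..\<delta>}. P s" by (intro exI[of _ "b / 2"]) auto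
next
  assume "\<exists>\<delta>>0. \<forall>s\<in>{0<..\<delta>}. P s"
  then show "\<forall>\<^sub>F s in at_right 0. P s"
    unfolding eventually_at_right_field by (meson greaterThanAtMost_iff less_imp_le)
qed

lemma equivalent_branches_refl: "equivalent_branches \<gamma> \<gamma>"
proof -
  have "C1_on {0..1} (\<lambda>s::real. s)"
    unfolding C1_on_def
    by (intro exI[of _ "\<lambda>_. 1"]) (auto intro!: derivative_eq_intros simp: has_vector_derivative_def)
  then show ?thesis
    unfolding equivalent_branches_def
    by (intro exI[of _ "1::real"] conjI exI[of _ "\<lambda>s::real. s"]) (auto simp: homeomorphism_def)
qed

text \<open>An injective reparametrization with \<open>\<alpha> 0 = 0\<close> approaches 0 through
  positive values, so what holds eventually along \<gamma> holds eventually along its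
  reparametrization, which is \<rho> near 0.\<close>

lemma equivalent_branches_eventually:
  assumes eq: "equivalent_branches \<gamma> \<rho>" and P: "\<forall>\<^sub>F s in at_right 0. P (\<gamma> s)"
  shows "\<forall>\<^sub>F s in at_right 0. P (\<rho> s)"
proof -
  obtain e1 e2 \<alpha> \<beta> e where e: "e1 > 0" "homeomorphism {0..e1} {0..e2} \<alpha> \<beta>" "\<alpha> 0 = 0"
    "e > 0" "e \<le> e1" "\<And>s. s \<in> {0..e} \<Longrightarrow> \<gamma> (\<alpha> s) = \<rho> s"
    using eq unfolding equivalent_branches_def by blast
  have pos: "\<alpha> s > 0" if "s \<in> {0<..e1}" for s
  proof -
    have "\<alpha> s \<ge> 0" using e(2) that unfolding homeomorphism_def by force
    moreover have "\<alpha> s \<noteq> \<alpha> 0"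
      using e(2) that e(1) unfolding homeomorphism_def by (metis atLeastAtMost_iff greaterThanAtMost_iff less_imp_le order.refl order_less_irrefl)
    ultimately show ?thesis using e(3) by simp
  qed
  have "(\<alpha> \<longlongrightarrow> \<alpha> 0) (at 0 within {0..e1})"
    using e(1,2) unfolding homeomorphism_def continuous_on_def by simp
  then have "(\<alpha> \<longlongrightarrow> 0) (at_right 0)" using e(1,3) by (simp add: at_within_Icc_at_right)
  moreover have "\<forall>\<^sub>F s in at_right 0. \<alpha> s > 0"
    unfolding eventually_at_right_0_iff using pos e(1) by blast
  ultimately have "filterlim \<alpha> (at_right 0) (at_right 0)"
    unfolding filterlim_at by (auto elim: eventually_mono)
  then have "\<forall>\<^sub>F s in at_right 0. P (\<gamma> (\<alpha> s))" using P by (rule eventually_compose_filterlim[rotated])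
  moreover have "\<forall>\<^sub>F s in at_right 0. s \<in> {0..e}"
    unfolding eventually_at_right_0_iff using e(4) by (intro exI[of _ e]) auto
  ultimately show ?thesis by eventually_elim (use e(6) in auto)
qed

text \<open>The definite description has one candidate only: every member of the class is a
  reparametrization of \<gamma>, so it eventually has index \<open>k\<close> too, and two eventual
  constants agree because the filter \<open>at_right 0\<close> is proper.\<close>

lemma class_index_eqI:
  assumes \<gamma>: "\<gamma> \<in> branches f" and k: "\<forall>\<^sub>F s in at_right 0. zero_index f (\<gamma> s) = k"
  shows "class_index f (branch_rel f `` {\<gamma>}) = k"
  unfolding class_index_def eventually_at_right_0_iff[symmetric]
proof (rule the_equality)
  show "\<exists>\<rho>\<in>branch_rel f `` {\<gamma>}. \<forall>\<^sub>F s in at_right 0. zero_index f (\<rho> s) = k"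
    using \<gamma> k equivalent_branches_refl[of \<gamma>] unfolding branch_rel_def by auto
next
  fix k' assume "\<exists>\<rho>\<in>branch_rel f `` {\<gamma>}. \<forall>\<^sub>F s in at_right 0. zero_index f (\<rho> s) = k'"
  then obtain \<rho> where "equivalent_branches \<gamma> \<rho>" and \<rho>: "\<forall>\<^sub>F s in at_right 0. zero_index f (\<rho> s) = k'"
    unfolding branch_rel_def by blast
  then have "\<forall>\<^sub>F s in at_right 0. zero_index f (\<rho> s) = k"
    using k by (rule_tac equivalent_branches_eventually)
  with \<rho> have "\<forall>\<^sub>F s in at_right (0::real). k' = k" by eventually_elim simp
  then show "k' = k" by simp
qed

lemma nontrivial_branches_subset: "nontrivial_branches f \<subseteq> branches f"
  unfolding nontrivial_branches_def branches_def by blast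

text \<open>Turns the definite description into a usable fact: it is the index at the points of the
  branch near 0.\<close>

lemma finite_hyperbolic_class_index:
  assumes f: "f \<in> families G \<phi>" and fh: "finite_hyperbolic f" and \<gamma>: "\<gamma> \<in> branches f"
  shows "\<forall>\<^sub>F s in at_right 0. zero_index f (\<gamma> s) = class_index f (branch_rel f `` {\<gamma>})"
    and "hyperbolic_branch f \<gamma>"
proof -
  have "branch_rel f `` {\<gamma>} \<in> Sigma_all f"
    unfolding Sigma_all_def using \<gamma> by (rule quotientI)
  moreover have "\<gamma> \<in> branch_rel f `` {\<gamma>}"
    using \<gamma> equivalent_branches_refl unfolding branch_rel_def by auto
  ultimately show hyp: "hyperbolic_branch f \<gamma>" using fh unfolding finite_hyperbolic_def by blast
  obtain \<delta> where "solution_branch_on f \<delta> \<gamma>" using \<gamma> unfolding branches_def by blast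
  then obtain k where k: "\<forall>\<^sub>F s in at_right 0. zero_index f (\<gamma> s) = k"
    using hyperbolic_branch_index_constant[OF families_smooth[OF f] _ hyp] by blast
  then show "\<forall>\<^sub>F s in at_right 0. zero_index f (\<gamma> s) = class_index f (branch_rel f `` {\<gamma>})"
    unfolding class_index_eqI[OF \<gamma> k] .
qed

lemma class_index_bounds:
  fixes f :: "'a::euclidean_space \<times> real \<Rightarrow> 'a"
  assumes irr: "absolutely_irreducible G \<phi>" and f: "f \<in> families G \<phi>" and fh: "finite_hyperbolic f"
    and Q: "quadratic_part f \<in> Q_zero G \<phi>" and c: "c \<in> Sigma_star f"
  shows "1 \<le> class_index f c \<and> class_index f c < DIM('a)"
proof -
  obtain \<gamma> where \<gamma>: "\<gamma> \<in> nontrivial_branches f" and c: "c = branch_rel f `` {\<gamma>}"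
    using c unfolding Sigma_star_def by (auto elim: quotientE)
  then have "\<gamma> \<in> branches f" using nontrivial_branches_subset by blast
  note k = finite_hyperbolic_class_index(1)[OF f fh this]
  obtain \<delta> where "solution_branch_on f \<delta> \<gamma>" "\<not> (\<forall>s\<in>{0<..\<delta>}. fst (\<gamma> s) = 0)"
    using \<gamma> unfolding nontrivial_branches_def by blast
  from nontrivial_branch_index[OF irr f Q this] k
  have "\<forall>\<^sub>F s in at_right (0::real). 1 \<le> class_index f c \<and> class_index f c < DIM('a)"
    unfolding c by eventually_elim simp
  then show ?thesis by simp
qed

subsection \<open>Quadratic perturbations\<close>

lemma iter_deriv_add_scaleR:
  assumes f: "smooth f" and h: "smooth h"
  shows "iter_deriv (\<lambda>p. f p + t *\<^sub>R h p) vs = (\<lambda>p. iter_deriv f vs p + t *\<^sub>R iter_deriv h vs p)"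
proof (induction vs)
  case (Cons v vs)
  have "((\<lambda>p. iter_deriv f vs p + t *\<^sub>R iter_deriv h vs p) has_derivative
      (\<lambda>d. iter_deriv f (d # vs) p + t *\<^sub>R iter_deriv h (d # vs) p)) (at p)" for p
    by (intro has_derivative_add has_derivative_scaleR_right smooth_has_derivative f h)
  from frechet_derivative_at[OF this] show ?case
    unfolding iter_deriv.simps(2)[of "\<lambda>p. f p + t *\<^sub>R h p"] Cons.IH by metis
qed simp

lemma smooth_add_scaleR:
  assumes f: "smooth f" and h: "smooth h"
  shows "smooth (\<lambda>p. f p + t *\<^sub>R h p)"
  unfolding smooth_def iter_deriv_add_scaleR[OF f h] using assms
  unfolding smooth_def by (auto intro!: derivative_intros)

text \<open>Twice the symmetric bilinear form of a quadratic map. It is expressed through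
  \<open>P\<close> alone, since the bilinear map in \<open>quadratic_equivariants\<close> need be
  neither symmetric nor unique.\<close>

definition polarization :: "('a::real_vector \<Rightarrow> 'a) \<Rightarrow> 'a \<Rightarrow> 'a \<Rightarrow> 'a" where
  "polarization P x y = P (x + y) - P x - P y"

lemma quadratic_equivariants_polarization:
  fixes P :: "'a::euclidean_space \<Rightarrow> 'a"
  assumes "P \<in> quadratic_equivariants G \<phi>"
  shows bilinear_polarization: "bilinear (polarization P)"
    and polarization_diag: "polarization P v v = 2 *\<^sub>R P v"
    and has_derivative_quadratic: "(P has_derivative polarization P x) (at x)"
proof -
  obtain B where B: "bilinear B" "\<And>v. P v = B v v"
    using assms unfolding quadratic_equivariants_def by blast
  have eq: "polarization P = (\<lambda>x y. B x y + B y x)"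
    by (simp add: fun_eq_iff polarization_def B(2) bilinear_ladd[OF B(1)] bilinear_radd[OF B(1)])
  show "bilinear (polarization P)"
    unfolding eq bilinear_def using B(1) unfolding bilinear_def by (auto intro: linear_compose_add)
  show "polarization P v v = 2 *\<^sub>R P v" unfolding eq B(2) by (simp add: scaleR_2)
  have "bounded_bilinear B" using B(1) by (simp add: bilinear_conv_bounded_bilinear)
  from bounded_bilinear.FDERIV[OF this has_derivative_ident has_derivative_ident]
  have "((\<lambda>v. B v v) has_derivative (\<lambda>h. B x h + B h x)) (at x)" .
  moreover have "P = (\<lambda>v. B v v)" using B(2) by (rule ext)
  ultimately show "(P has_derivative polarization P x) (at x)" using eq by metis
qed

lemma has_derivative_quadratic_fst:
  fixes P :: "'a::euclidean_space \<Rightarrow> 'a"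
  assumes "P \<in> quadratic_equivariants G \<phi>"
  shows "((\<lambda>p. P (fst p)) has_derivative (\<lambda>d. polarization P (fst p) (fst d))) (at (p :: 'a \<times> real))"
  by (rule has_derivative_compose[OF has_derivative_fst[OF has_derivative_ident] has_derivative_quadratic[OF assms]])

lemma iter_deriv_quadratic_1:
  assumes "P \<in> quadratic_equivariants G \<phi>"
  shows "iter_deriv (\<lambda>p :: 'a::euclidean_space \<times> real. P (fst p)) [v] = (\<lambda>p. polarization P (fst p) (fst v))"
proof
  fix p :: "'a \<times> real"
  show "iter_deriv (\<lambda>p. P (fst p)) [v] p = polarization P (fst p) (fst v)"
    using fun_cong[OF frechet_derivative_at[OF has_derivative_quadratic_fst[OF assms, of p]], of v] by simp
qed

lemma has_derivative_polarization_fst: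
  fixes P :: "'a::euclidean_space \<Rightarrow> 'a"
  assumes "P \<in> quadratic_equivariants G \<phi>"
  shows "((\<lambda>p. polarization P (fst p) y) has_derivative (\<lambda>d. polarization P (fst d) y)) (at (p :: 'a \<times> real))"
proof -
  have "linear (\<lambda>x. polarization P x y)"
    using bilinear_polarization[OF assms] by (simp add: bilinear_def)
  then have "bounded_linear (\<lambda>x. polarization P x y)" by (simp add: linear_conv_bounded_linear)
  from bounded_linear.has_derivative[OF this has_derivative_fst[OF has_derivative_ident]]
  show ?thesis .
qed

lemma iter_deriv_quadratic_2:
  assumes "P \<in> quadratic_equivariants G \<phi>"
  shows "iter_deriv (\<lambda>p :: 'a::euclidean_space \<times> real. P (fst p)) [w, v] = (\<lambda>p. polarization P (fst w) (fst v))"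
  unfolding iter_deriv.simps(2)[of _ w] iter_deriv_quadratic_1[OF assms]
  using frechet_derivative_at[OF has_derivative_polarization_fst[OF assms]] by metis

text \<open>Directions are applied from the end of the list, so its last three entries are the first
  three derivatives, and the third one already annihilates a quadratic map.\<close>

lemma iter_deriv_quadratic_3:
  assumes "P \<in> quadratic_equivariants G \<phi>"
  shows "iter_deriv (\<lambda>p :: 'a::euclidean_space \<times> real. P (fst p)) (us @ [u, w, v]) = (\<lambda>p. 0)"
proof (induction us)
  case Nil
  show ?case
    unfolding append_Nil iter_deriv.simps(2)[of _ u] iter_deriv_quadratic_2[OF assms] by simp
next
  case (Cons x us)
  show ?case
    unfolding append_Cons iter_deriv.simps(2)[of _ x] Cons.IH by simp
qed

lemma list_length_cases:
  obtains "vs = []" | v where "vs = [v]" | v w where "vs = [w, v]" | us u v w where "vs = us @ [u, w, v]"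
proof (cases vs rule: rev_cases)
  case (snoc ys v)
  note 1 = this
  show thesis
  proof (cases ys rule: rev_cases)
    case (snoc zs w)
    then show thesis using 1 that by (cases zs rule: rev_cases) auto
  qed (use 1 that in auto)
qed (use that in auto)

lemma smooth_quadratic_fst:
  fixes P :: "'a::euclidean_space \<Rightarrow> 'a"
  assumes "P \<in> quadratic_equivariants G \<phi>"
  shows "smooth (\<lambda>p :: 'a \<times> real. P (fst p))"
  unfolding smooth_def
proof (intro allI)
  fix vs and p :: "'a \<times> real"
  show "iter_deriv (\<lambda>p :: 'a \<times> real. P (fst p)) vs differentiable (at p)"
  proof (cases vs rule: list_length_cases)
    case 1
    show ?thesis unfolding 1 iter_deriv.simps(1) differentiable_def
      using has_derivative_quadratic_fst[OF assms, of p] by blast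
  next
    case (2 v)
    show ?thesis unfolding 2 iter_deriv_quadratic_1[OF assms] differentiable_def
      using has_derivative_polarization_fst[OF assms, of "fst v" p] by blast
  next
    case (3 v w)
    then show ?thesis unfolding 3 iter_deriv_quadratic_2[OF assms] by simp
  next
    case (4 us u v w)
    then show ?thesis unfolding 4 iter_deriv_quadratic_3[OF assms] by simp
  qed
qed

text \<open>Derivatives of every order are controlled by the size on the unit sphere, so the order
  \<open>r\<close> of the topology is immaterial. Along directions of norm at most 1, orders 0, 1
  and 2 give the factors \<open>M\<^sup>2\<close>, \<open>M\<^sup>2 + 1\<close> and 2, all covered
  by \<open>M\<^sup>2 + 2\<close>.\<close>

lemma norm_iter_deriv_quadratic_le:
  fixes P :: "'a::euclidean_space \<Rightarrow> 'a" and p :: "'a \<times> real"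
  assumes P: "P \<in> quadratic_equivariants G \<phi>"
    and \<eta>: "\<And>u. u \<in> sphere 0 1 \<Longrightarrow> norm (P u) \<le> \<eta>" "\<eta> \<ge> 0"
    and M: "norm p \<le> M" and vs: "\<forall>v\<in>set vs. norm v \<le> 1"
  shows "norm (iter_deriv (\<lambda>p. P (fst p)) vs p) \<le> \<eta> * (M\<^sup>2 + 2)"
proof -
  note bil = bilinear_polarization[OF P]
  have quad: "norm (P x) \<le> \<eta> * (norm x)\<^sup>2" for x
  proof (cases "x = 0")
    case True
    then have "2 *\<^sub>R P x = 0" using polarization_diag[OF P, of x] bilinear_lzero[OF bil] by simp
    then show ?thesis using True by simp
  next
    case False
    define u where "u = (1 / norm x) *\<^sub>R x"
    have "polarization P x x = (norm x * norm x) *\<^sub>R polarization P u u"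
      using False unfolding u_def by (simp add: bilinear_lmul[OF bil] bilinear_rmul[OF bil])
    then have "P x = (norm x * norm x) *\<^sub>R P u"
      unfolding polarization_diag[OF P] by (metis scaleR_left_commute scaleR_cancel_left zero_neq_numeral)
    moreover have "norm (P u) \<le> \<eta>" using False by (intro \<eta>(1)) (simp add: u_def)
    ultimately show ?thesis
      by (simp add: power2_eq_square mult.commute[of \<eta>] mult_left_mono)
  qed
  \<comment> \<open>Twice the polarization is the difference of the values at \<open>x + y\<close>
    and \<open>x - y\<close>, and the parallelogram law removes the mixed terms.\<close>
  have pol: "norm (polarization P x y) \<le> \<eta> * ((norm x)\<^sup>2 + (norm y)\<^sup>2)" for x y
  proof -
    have "polarization P x (- y) = - polarization P x y" by (rule bilinear_rneg[OF bil])
    moreover have "P (- y) = P y"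
    proof -
      have "2 *\<^sub>R P (- y) = 2 *\<^sub>R P y"
        unfolding polarization_diag[OF P, symmetric] by (simp add: bilinear_lneg[OF bil] bilinear_rneg[OF bil])
      then show ?thesis by simp
    qed
    ultimately have "2 *\<^sub>R polarization P x y = P (x + y) - P (x - y)"
      unfolding polarization_def by (simp add: scaleR_2 algebra_simps)
    then have "2 * norm (polarization P x y) = norm (P (x + y) - P (x - y))"
      by (metis abs_numeral norm_scaleR)
    also have "\<dots> \<le> \<eta> * (norm (x + y))\<^sup>2 + \<eta> * (norm (x - y))\<^sup>2"
      using norm_triangle_ineq4 quad by (smt (verit))
    also have "\<dots> = 2 * (\<eta> * ((norm x)\<^sup>2 + (norm y)\<^sup>2))"
      by (simp add: power2_norm_eq_inner inner_add_left inner_add_right inner_diff_left inner_diff_right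
          inner_commute algebra_simps)
    finally show ?thesis by simp
  qed
  have fst_le: "(norm (fst q))\<^sup>2 \<le> r\<^sup>2" if "norm q \<le> r" for q :: "'a \<times> real" and r
    using that norm_fst_le[of "fst q" "snd q"] by (intro power_mono) auto
  show ?thesis
  proof (cases vs rule: list_length_cases)
    case 1
    have "norm (P (fst p)) \<le> \<eta> * (norm (fst p))\<^sup>2" by (rule quad)
    also have "\<dots> \<le> \<eta> * (M\<^sup>2 + 2)" using fst_le[OF M] \<eta>(2) by (intro mult_left_mono) auto
    finally show ?thesis using 1 by simp
  next
    case (2 v)
    have "norm (polarization P (fst p) (fst v)) \<le> \<eta> * ((norm (fst p))\<^sup>2 + (norm (fst v))\<^sup>2)" by (rule pol)
    also have "\<dots> \<le> \<eta> * (M\<^sup>2 + 2)"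
      using fst_le[OF M] fst_le[of v 1] \<eta>(2) vs 2 by (intro mult_left_mono) auto
    finally show ?thesis unfolding 2 iter_deriv_quadratic_1[OF P] .
  next
    case (3 v w)
    have "norm (polarization P (fst w) (fst v)) \<le> \<eta> * ((norm (fst w))\<^sup>2 + (norm (fst v))\<^sup>2)" by (rule pol)
    also have "\<dots> \<le> \<eta> * (M\<^sup>2 + 2)"
      using fst_le[of w 1] fst_le[of v 1] \<eta>(2) vs 3 by (intro mult_left_mono) (auto simp: add_increasing)
    finally show ?thesis unfolding 3 iter_deriv_quadratic_2[OF P] .
  next
    case (4 us u v w)
    show ?thesis unfolding 4 iter_deriv_quadratic_3[OF P] using \<eta>(2) by simp
  qed
qed

text \<open>A quadratic map has zero derivative at the origin and is absorbed into the higher-order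
  term \<open>F\<close>.\<close>

lemma add_quadratic_in_families:
  fixes f :: "'a::euclidean_space \<times> real \<Rightarrow> 'a"
  assumes irr: "absolutely_irreducible G \<phi>" and f: "f \<in> families G \<phi>" and P: "P \<in> quadratic_equivariants G \<phi>"
  shows "(\<lambda>p. f p + t *\<^sub>R P (fst p)) \<in> families G \<phi>"
proof -
  obtain F where F: "\<And>v l. f (v, l) = l *\<^sub>R v + F (v, l)"
    "\<And>l. ((\<lambda>v. F (v, l)) has_derivative (\<lambda>_. 0)) (at 0)"
    using f unfolding families_def by blast
  have equiv: "f (\<phi> g v, l) + t *\<^sub>R P (\<phi> g v) = \<phi> g (f (v, l) + t *\<^sub>R P v)" if g: "g \<in> carrier G" for g v l
    using families_equivariant[OF f g] P g linear_action[OF irr g]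
    by (simp add: quadratic_equivariants_def equivariant_def linear_add linear_cmul)
  have "polarization P 0 = (\<lambda>_. 0)"
    by (rule ext) (rule bilinear_lzero[OF bilinear_polarization[OF P]])
  then have "(P has_derivative (\<lambda>_. 0)) (at 0)"
    using has_derivative_quadratic[OF P, of 0] by metis
  then have "((\<lambda>v. F (v, l) + t *\<^sub>R P v) has_derivative (\<lambda>d. 0 + t *\<^sub>R 0)) (at 0)" for l
    by (intro has_derivative_add F has_derivative_scaleR_right)
  then have "((\<lambda>v. F (v, l) + t *\<^sub>R P (fst (v, l))) has_derivative (\<lambda>_. 0)) (at 0)" for l
    by simp
  then have "\<exists>F'. (\<forall>v l. f (v, l) + t *\<^sub>R P v = l *\<^sub>R v + F' (v, l)) \<and>
      (\<forall>l. ((\<lambda>v. F' (v, l)) has_derivative (\<lambda>_. 0)) (at 0))"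
    by (intro exI[of _ "\<lambda>p. F p + t *\<^sub>R P (fst p)"]) (simp add: F(1))
  then show ?thesis
    unfolding families_def
    using equiv smooth_add_scaleR[OF families_smooth[OF f] smooth_quadratic_fst[OF P]] by simp
qed

lemma quadratic_part_add_quadratic:
  assumes f: "f \<in> families G \<phi>" and P: "P \<in> quadratic_equivariants G \<phi>"
  shows "quadratic_part (\<lambda>p. f p + t *\<^sub>R P (fst p)) v = quadratic_part f v + t *\<^sub>R P v"
  unfolding quadratic_part_def second_state_derivative_def
    iter_deriv_add_scaleR[OF families_smooth[OF f] smooth_quadratic_fst[OF P]] iter_deriv_quadratic_2[OF P]
  by (simp add: polarization_diag[OF P] scaleR_add_right del: iter_deriv.simps)

lemma quadratic_equivariants_bounded:
  fixes P :: "'a::euclidean_space \<Rightarrow> 'a"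
  assumes P: "P \<in> quadratic_equivariants G \<phi>"
  obtains \<eta> where "\<eta> \<ge> 0" "\<And>u. u \<in> sphere 0 1 \<Longrightarrow> norm (P u) \<le> \<eta>"
proof -
  have "continuous_on (sphere 0 1) P"
    using has_derivative_quadratic[OF P] by (meson continuous_at_imp_continuous_on has_derivative_continuous)
  then have "bounded (P ` sphere 0 1)"
    by (intro compact_imp_bounded compact_continuous_image) auto
  then obtain B where "\<And>u. u \<in> sphere 0 1 \<Longrightarrow> norm (P u) \<le> B"
    unfolding bounded_iff by blast
  then show ?thesis using that[of "max 0 B"] by (simp add: le_max_iff_disj)
qed

section \<open>The path of quadratic perturbations\<close>

lemma topspace_family_topology: "topspace (family_topology G \<phi> r) = families G \<phi>"
proof -
  have "openin (family_topology G \<phi> r) (families G \<phi>)"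
    unfolding openin_family_topology
    by (auto simp: family_nhd_def intro!: exI[of _ "{}"] exI[of _ "1::real"])
  moreover have "topspace (family_topology G \<phi> r) \<subseteq> families G \<phi>"
    using openin_topspace[of "family_topology G \<phi> r"] unfolding openin_family_topology by blast
  ultimately show ?thesis by (meson openin_subset subset_antisym)
qed

lemma add_quadratic_in_family_nhd:
  fixes f :: "'a::euclidean_space \<times> real \<Rightarrow> 'a"
  assumes irr: "absolutely_irreducible G \<phi>" and f: "f \<in> families G \<phi>" and P: "P \<in> quadratic_equivariants G \<phi>"
    and \<eta>: "\<And>u. u \<in> sphere 0 1 \<Longrightarrow> norm (P u) \<le> \<eta>" "\<eta> \<ge> 0"
    and M: "\<And>p. p \<in> K \<Longrightarrow> norm p \<le> M" and small: "\<bar>t\<bar> * (\<eta> * (M\<^sup>2 + 2)) < e"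
  shows "(\<lambda>p. f p + t *\<^sub>R P (fst p)) \<in> family_nhd G \<phi> r f K e"
proof -
  have "norm (iter_deriv (\<lambda>p. f p + t *\<^sub>R P (fst p)) vs p - iter_deriv f vs p) < e"
    if "p \<in> K" "\<forall>v\<in>set vs. norm v \<le> 1" for p vs
  proof -
    have "norm (iter_deriv (\<lambda>p. P (fst p)) vs p) \<le> \<eta> * (M\<^sup>2 + 2)"
      using norm_iter_deriv_quadratic_le[OF P \<eta> M[OF that(1)] that(2)] .
    then have "\<bar>t\<bar> * norm (iter_deriv (\<lambda>p. P (fst p)) vs p) \<le> \<bar>t\<bar> * (\<eta> * (M\<^sup>2 + 2))"
      by (intro mult_left_mono) auto
    then show ?thesis
      unfolding iter_deriv_add_scaleR[OF families_smooth[OF f] smooth_quadratic_fst[OF P]]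
      using small by simp
  qed
  then show ?thesis
    unfolding family_nhd_def using add_quadratic_in_families[OF irr f P] by blast
qed

text \<open>The path is affine in \<open>t\<close>, so near each of its points it is again a small
  quadratic perturbation of the family there, with coefficient \<open>t' - t\<close>.\<close>

lemma continuous_map_add_quadratic:
  fixes f :: "'a::euclidean_space \<times> real \<Rightarrow> 'a"
  assumes irr: "absolutely_irreducible G \<phi>" and f: "f \<in> families G \<phi>" and P: "P \<in> quadratic_equivariants G \<phi>"
  shows "continuous_map (top_of_set {0..1::real}) (family_topology G \<phi> r) (\<lambda>t p. f p + t *\<^sub>R P (fst p))"
  unfolding continuous_map_def topspace_family_topology
proof (intro conjI allI impI Pi_I add_quadratic_in_families[OF irr f P])
  fix U assume U: "openin (family_topology G \<phi> r) U"
  let ?f = "\<lambda>t p. f p + t *\<^sub>R P (fst p)"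
  obtain \<eta> where \<eta>: "\<eta> \<ge> 0" "\<And>u. u \<in> sphere 0 1 \<Longrightarrow> norm (P u) \<le> \<eta>"
    using quadratic_equivariants_bounded[OF P] by blast
  show "openin (top_of_set {0..1}) {t \<in> topspace (top_of_set {0..1}). ?f t \<in> U}"
    unfolding openin_euclidean_subtopology_iff
  proof (intro conjI ballI)
    fix t assume t: "t \<in> {t \<in> topspace (top_of_set {0..1}). ?f t \<in> U}"
    then obtain K e where K: "compact K" "e > 0" "family_nhd G \<phi> r (?f t) K e \<subseteq> U"
      using U unfolding openin_family_topology by blast
    obtain M where M: "\<And>p. p \<in> K \<Longrightarrow> norm p \<le> M"
      using compact_imp_bounded[OF K(1)] unfolding bounded_iff by blast
    define C where "C = \<eta> * (M\<^sup>2 + 2) + 1"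
    have C: "C > 0" unfolding C_def using \<eta>(1) by (simp add: add_nonneg_pos)
    have "?f t' \<in> U" if "dist t' t < e / C" for t'
    proof -
      have "\<bar>t' - t\<bar> * (\<eta> * (M\<^sup>2 + 2)) \<le> \<bar>t' - t\<bar> * C"
        unfolding C_def by (intro mult_left_mono) auto
      also have "\<dots> < e" using that C by (simp add: dist_real_def pos_less_divide_eq)
      finally have "(\<lambda>p. ?f t p + (t' - t) *\<^sub>R P (fst p)) \<in> family_nhd G \<phi> r (?f t) K e"
        by (intro add_quadratic_in_family_nhd[OF irr add_quadratic_in_families[OF irr f P] P \<eta>(2,1) M])
      also have "(\<lambda>p. ?f t p + (t' - t) *\<^sub>R P (fst p)) = ?f t'"
        by (simp add: fun_eq_iff scaleR_left_diff_distrib)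
      finally show ?thesis using K(3) by blast
    qed
    then show "\<exists>e>0. \<forall>t'\<in>{0..1}. dist t' t < e \<longrightarrow> t' \<in> {t \<in> topspace (top_of_set {0..1}). ?f t \<in> U}"
      using K(2) C by (intro exI[of _ "e / C"]) auto
  qed auto
qed

section \<open>Approximation within \<open>Q_zero\<close> and transfer of the index\<close>

lemma Q_zero_near:
  assumes G: "property_G G \<phi>" and Q: "Q \<in> quadratic_equivariants G \<phi>" and \<eta>: "\<eta> > 0"
  obtains R where "R \<in> Q_zero G \<phi>" "\<And>u. u \<in> sphere 0 1 \<Longrightarrow> norm (R u - Q u) \<le> \<eta>"
proof -
  \<comment> \<open>An open ball in the supremum norm. A bound \<open>e < \<eta>\<close> uniform in
    \<open>u\<close>, instead of a pointwise strict inequality, leaves a margin from which openness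
    is immediate.\<close>
  define T where "T = {R \<in> quadratic_equivariants G \<phi>. \<exists>e<\<eta>. \<forall>u\<in>sphere 0 1. norm (R u - Q u) \<le> e}"
  have "openin (quadratic_topology G \<phi>) T"
    unfolding openin_quadratic_topology
  proof (intro conjI ballI)
    fix R assume "R \<in> T"
    then obtain e where e: "e < \<eta>" "\<And>u. u \<in> sphere 0 1 \<Longrightarrow> norm (R u - Q u) \<le> e" unfolding T_def by blast
    show "\<exists>e>0. \<forall>R'\<in>quadratic_equivariants G \<phi>. (\<forall>u\<in>sphere 0 1. norm (R' u - R u) < e) \<longrightarrow> R' \<in> T"
    proof (intro exI[of _ "(\<eta> - e) / 2"] conjI ballI impI)
      fix R' assume R': "R' \<in> quadratic_equivariants G \<phi>" "\<forall>u\<in>sphere 0 1. norm (R' u - R u) < (\<eta> - e) / 2"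
      have "norm (R' u - Q u) \<le> (\<eta> + e) / 2" if u: "u \<in> sphere 0 1" for u
      proof -
        have "norm (R' u - Q u) \<le> norm (R' u - R u) + norm (R u - Q u)"
          using norm_triangle_ineq[of "R' u - R u" "R u - Q u"] by simp
        also have "\<dots> \<le> (\<eta> - e) / 2 + e" using R'(2) e(2)[OF u] u by (intro add_mono) (auto intro: less_imp_le)
        finally show ?thesis by (simp add: field_simps)
      qed
      then show "R' \<in> T" unfolding T_def using R'(1) e(1) by (auto intro!: exI[of _ "(\<eta> + e) / 2"])
    qed (use e(1) in simp)
  qed (auto simp: T_def)
  moreover have "Q \<in> T" unfolding T_def using Q \<eta> by (auto intro!: exI[of _ 0])
  moreover have "Q \<in> Abstract_Topology.closure_of (quadratic_topology G \<phi>) (Q_zero G \<phi>)"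
    using G Q unfolding property_G_def by simp
  ultimately obtain R where "R \<in> Q_zero G \<phi>" "R \<in> T" unfolding in_closure_of by blast
  then show ?thesis using that[of R] unfolding T_def by force
qed

lemma quadratic_equivariants_diff:
  assumes irr: "absolutely_irreducible G \<phi>"
    and R: "R \<in> quadratic_equivariants G \<phi>" and Q: "Q \<in> quadratic_equivariants G \<phi>"
  shows "(\<lambda>v. R v - Q v) \<in> quadratic_equivariants G \<phi>"
proof -
  obtain B C where B: "bilinear B" "\<And>v. R v = B v v" and C: "bilinear C" "\<And>v. Q v = C v v"
    using R Q unfolding quadratic_equivariants_def by blast
  have "bilinear (\<lambda>x y. B x y - C x y)"
    using B(1) C(1) unfolding bilinear_def by (auto intro: linear_compose_sub)
  moreover have "equivariant G \<phi> (\<lambda>v. R v - Q v)"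
    using R Q linear_diff[OF linear_action[OF irr]] unfolding quadratic_equivariants_def equivariant_def by simp
  ultimately show ?thesis
    unfolding quadratic_equivariants_def using B(2) C(2) by auto
qed

lemma stable_family_class_index:
  fixes f :: "'a::euclidean_space \<times> real \<Rightarrow> 'a"
  assumes irr: "absolutely_irreducible G \<phi>" and G: "property_G G \<phi>"
    and f: "f \<in> stable_families G \<phi>" and c: "c \<in> Sigma_star f"
  shows "1 \<le> class_index f c \<and> class_index f c < DIM('a)"
proof -
  have fam: "f \<in> families G \<phi>" using f by (simp add: stable_families_def)
  obtain r U where U: "U \<subseteq> families G \<phi>" "f \<in> (family_topology G \<phi> r) interior_of U"
    and stable: "\<And>ft. continuous_map (top_of_set {0..1::real}) (subtopology (family_topology G \<phi> r) U) ft \<Longrightarrow>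
      ft 0 = f \<Longrightarrow> \<forall>t\<in>{0..1}. Sigma_star_isomorphic G \<phi> f (ft t)"
    by (insert f[unfolded stable_families_def mem_Collect_eq], elim conjE exE, rule that, assumption, assumption,
        drule spec, drule mp, rule conjI, assumption, assumption, erule conjunct2)
  obtain W where W: "openin (family_topology G \<phi> r) W" "f \<in> W" "W \<subseteq> U"
    using U(2) unfolding interior_of_def by blast
  then obtain K e where K: "compact K" "e > 0" "family_nhd G \<phi> r f K e \<subseteq> W"
    unfolding openin_family_topology by blast
  obtain M where M: "\<And>p. p \<in> K \<Longrightarrow> norm p \<le> M"
    using compact_imp_bounded[OF K(1)] unfolding bounded_iff by blast
  \<comment> \<open>Chosen so that the whole path, up to the full perturbation at
    \<open>t = 1\<close>, stays in the given neighbourhood; the factor 2 makes the inequality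
    strict.\<close>
  define \<eta> where "\<eta> = e / (2 * (M\<^sup>2 + 2))"
  have M2: "M\<^sup>2 + 2 > 0" by (simp add: add_nonneg_pos)
  have \<eta>: "\<eta> > 0" "\<eta> * (M\<^sup>2 + 2) < e" 
  proof -
    have half: "e / (2 * N) * N = e / 2" if "N > 0" for N :: real using that by simp
    show "\<eta> * (M\<^sup>2 + 2) < e" unfolding \<eta>_def half[OF M2] using K(2) by simp
    show "\<eta> > 0" using K(2) M2 unfolding \<eta>_def by simp
  qed
  note Q = quadratic_part_in_quadratic_equivariants[OF irr fam]
  obtain R where R: "R \<in> Q_zero G \<phi>" "\<And>u. u \<in> sphere 0 1 \<Longrightarrow> norm (R u - quadratic_part f u) \<le> \<eta>"
    using Q_zero_near[OF G Q \<eta>(1)] by blast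
  \<comment> \<open>With this perturbation the family at \<open>t = 1\<close> has quadratic part
    exactly \<open>R\<close>.\<close>
  define P where "P v = R v - quadratic_part f v" for v
  have P: "P \<in> quadratic_equivariants G \<phi>"
    unfolding P_def[abs_def] using R(1) by (intro quadratic_equivariants_diff[OF irr _ Q]) (simp add: Q_zero_def)
  define ft where "ft t p = f p + t *\<^sub>R P (fst p)" for t :: real and p
  have "ft t \<in> U" if t: "t \<in> {0..1}" for t
  proof -
    have "\<bar>t\<bar> * (\<eta> * (M\<^sup>2 + 2)) \<le> 1 * (\<eta> * (M\<^sup>2 + 2))"
      using t \<eta>(1) M2 by (intro mult_right_mono) auto
    then have small: "\<bar>t\<bar> * (\<eta> * (M\<^sup>2 + 2)) < e" using \<eta>(2) by linarith
    have "ft t \<in> family_nhd G \<phi> r f K e"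
      unfolding ft_def[abs_def]
      by (rule add_quadratic_in_family_nhd[OF irr fam P _ _ M small]) (use R(2) \<eta>(1) in \<open>simp_all add: P_def\<close>)
    then show ?thesis using K(3) W(3) by blast
  qed
  then have "continuous_map (top_of_set {0..1}) (subtopology (family_topology G \<phi> r) U) ft"
    unfolding continuous_map_in_subtopology using continuous_map_add_quadratic[OF irr fam P, of r]
    by (auto simp: ft_def[abs_def])
  moreover have "ft 0 = f" by (simp add: ft_def[abs_def])
  ultimately have "Sigma_star_isomorphic G \<phi> f (ft 1)"
    using stable[of ft] by simp
  then obtain \<Phi> where fh: "finite_hyperbolic (ft 1)" and bij: "bij_betw \<Phi> (Sigma_star f) (Sigma_star (ft 1))"
    and index: "class_index (ft 1) (\<Phi> c) = class_index f c"
    using c unfolding Sigma_star_isomorphic_def by blast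
  have fam1: "ft 1 \<in> families G \<phi>"
    unfolding ft_def[abs_def] by (rule add_quadratic_in_families[OF irr fam P])
  have "quadratic_part (ft 1) = R"
    by (rule ext) (simp only: ft_def[abs_def] quadratic_part_add_quadratic[OF fam P], simp add: P_def)
  then have "quadratic_part (ft 1) \<in> Q_zero G \<phi>" using R(1) by simp
  moreover have "\<Phi> c \<in> Sigma_star (ft 1)" using bij c by (auto simp: bij_betw_def)
  ultimately show ?thesis
    using class_index_bounds[OF irr fam1 fh] index by metis
qed

theorem theorem3p6:
  fixes G :: "('g, 'm) monoid_scheme"
    and \<phi> :: "'g \<Rightarrow> 'a::euclidean_space \<Rightarrow> 'a"
  assumes "absolutely_irreducible G \<phi>"
    and "has_quadratic_equivariants G \<phi>"
    and "property_G G \<phi>"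
  shows "\<forall>f \<in> stable_families G \<phi>.
     (\<forall>c \<in> Sigma_star f. 1 \<le> class_index f c \<and> class_index f c \<le> DIM('a) - 1) \<and>
     (\<forall>\<gamma> \<in> nontrivial_branches f.
        (\<exists>\<delta>>0. \<forall>s\<in>{0<..\<delta>}. hyperbolic_saddle f (\<gamma> s)) \<and>
        \<not> (\<exists>\<delta>>0. \<forall>s\<in>{0<..\<delta>}. hyperbolic_sink f (\<gamma> s)) \<and>
        \<not> (\<exists>\<delta>>0. \<forall>s\<in>{0<..\<delta>}. hyperbolic_source f (\<gamma> s)))"
proof (intro ballI conjI)
  fix f assume f: "f \<in> stable_families G \<phi>"
  note bounds = stable_family_class_index[OF assms(1,3) f]
  {
    fix c assume "c \<in> Sigma_star f"
    \<comment> \<open>Truncated subtraction is harmless here: the bounds force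
      \<open>DIM('a)\<close> to be at least 2.\<close>
    from bounds[OF this] show "1 \<le> class_index f c" "class_index f c \<le> DIM('a) - 1" by auto
  }
  fix \<gamma> assume \<gamma>: "\<gamma> \<in> nontrivial_branches f"
  have fam: "f \<in> families G \<phi>" "finite_hyperbolic f" using f by (simp_all add: stable_families_def)
  note \<gamma>' = subsetD[OF nontrivial_branches_subset \<gamma>]
  have "branch_rel f `` {\<gamma>} \<in> Sigma_star f"
    unfolding Sigma_star_def using \<gamma> by (rule quotientI)
  note bounds = bounds[OF this]
  note index = finite_hyperbolic_class_index(1)[OF fam \<gamma>']
  have "\<forall>\<^sub>F s in at_right 0. hyperbolic_zero f (\<gamma> s)"
    using finite_hyperbolic_class_index(2)[OF fam \<gamma>']
    unfolding hyperbolic_branch_def eventually_at_right_0_iff .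
  with index have saddle: "\<forall>\<^sub>F s in at_right 0. hyperbolic_saddle f (\<gamma> s)"
    by eventually_elim (use bounds in \<open>simp add: hyperbolic_saddle_def\<close>)
  then show "\<exists>\<delta>>0. \<forall>s\<in>{0<..\<delta>}. hyperbolic_saddle f (\<gamma> s)"
    unfolding eventually_at_right_0_iff .
  show "\<not> (\<exists>\<delta>>0. \<forall>s\<in>{0<..\<delta>}. hyperbolic_sink f (\<gamma> s))"
    unfolding eventually_at_right_0_iff[symmetric]
  proof
    assume "\<forall>\<^sub>F s in at_right 0. hyperbolic_sink f (\<gamma> s)"
    \<comment> \<open>Both properties hold on a common interval, where the values of the index
      contradict each other.\<close>
    with saddle have "\<forall>\<^sub>F s in at_right (0::real). False"
      by eventually_elim (simp add: hyperbolic_saddle_def hyperbolic_sink_def)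
    then show False by simp
  qed
  show "\<not> (\<exists>\<delta>>0. \<forall>s\<in>{0<..\<delta>}. hyperbolic_source f (\<gamma> s))"
    unfolding eventually_at_right_0_iff[symmetric]
  proof
    assume "\<forall>\<^sub>F s in at_right 0. hyperbolic_source f (\<gamma> s)"
    with saddle have "\<forall>\<^sub>F s in at_right (0::real). False"
      by eventually_elim (simp add: hyperbolic_saddle_def hyperbolic_source_def)
    then show False by simp
  qed
qed

end
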